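(* Assume (A1)--(A5) (listed in the context) for the baseline $P$ and the constraint set $E$, and let $\varepsilon_N\downarrow0$ with $N\varepsilon_N>c_{\mathrm{rnd}}$ for all sufficiently large $N$. Then for all sufficiently large $N$, every $\delta>0$, and every $m$-element index set $I_N\subseteq\{1,\dots,N\}$, $$\big\|L_{N,I_N,P}-(P^\bullet)^{\otimes m}\big\|_{\mathrm{TV}}\le m\delta+\frac{m(m-1)}{2N}+\beta_N,$$ where $\beta_N=\mathbb P_P(\widehat P_N\in B_{N,\delta}\mid E_N)$, and $$\beta_N\le C(P,E)\,(N+1)^{2k}e^{-2N\delta^2}$$ for a finite constant $C(P,E)$.
   Context: Let $\mathcal X=\{1,\dots,k\}$, let $\Delta(\mathcal X)$ be the probability simplex, $\|P-Q\|_{\mathrm{TV}}=\tfrac12\sum_x|P(x)-Q(x)|$, $D(Q\|P)=\sum_xQ(x)\log\{Q(x)/P(x)\}$, $\langle g,Q\rangle=\sum_x g(x)Q(x)$. Let $r\ge 1$, $0\le r_0\le r$, $g_1,\dots,g_r:\mathcal X\to\mathbb R$, $\alpha_1,\dots,\alpha_r\in\mathbb R$, and $$E=\{Q\in\Delta(\mathcal X):\langle g_j,Q\rangle=\alpha_j\ (j\le r_0),\ \langle g_j,Q\rangle\ge\alpha_j\ (r_0<j\le r)\},$$ $$E_\varepsilon=\{Q\in\Delta(\mathcal X):|\langle g_j,Q\rangle-\alpha_j|\le\varepsilon\ (j\le r_0),\ \langle g_j,Q\rangle\ge\alpha_j-\varepsilon\ (r_0<j\le r)\}\quad(\varepsilon\ge0).$$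 Put $c_{\mathrm{rnd}}=k\max_j\|g_j\|_\infty$. For $P\in\Delta(\mathcal X)$ let $P^\star=\arg\min_{Q\in E}D(Q\|P)$ and $P^\star_\varepsilon=\arg\min_{Q\in E_\varepsilon}D(Q\|P)$. Assumptions: (A1) $k<\infty$. (A2) $\min_xP(x)>0$. (A3) $E$ is nonempty (closed and convex). (A4) $\min_xP^\star(x)>0$. (A5) For some $C_0<\infty$, $\|P^\star_\varepsilon-P^\star_{\varepsilon'}\|_{\mathrm{TV}}\le C_0|\varepsilon-\varepsilon'|$ whenever $\varepsilon,\varepsilon'\ge0$ are sufficiently small. $X_1,\dots,X_N$ are i.i.d. $P$ under $\mathbb P_P$, $\widehat P_N=\frac1N\sum_{i=1}^N\delta_{X_i}$, $E_N=\{\widehat P_N\in E_{\varepsilon_N}\}$; for an $m$-element $I_N\subseteq\{1,\dots,N\}$, $L_{N,I_N,P}$ is the conditional law of $(X_i)_{i\in I_N}$ under $\mathbb P_P$ given $E_N$. Write $P^\bullet=P^\star_{\varepsilon_N}$, let $\mathcal T_N=\{n/N:n\in\mathbb N_0^k,\ \sum_jn_j=N\}$ be the set of types, and let $$B_{N,\delta}=\{Q\in E_{\varepsilon_N}\cap\mathcal T_N:\|Q-P^\bullet\|_{\mathrm{TV}}>\delta\}.$$ $C(P,E)$ denotes a finite constant depending only on $P$ and the data $(g_j,\alpha_j,r_0,r)$ defining $E$ and its windows, not on $N,m,I_N,\delta$. *)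

theory Defs
  imports "HOL-Probability.Probability"
begin

text \<open>The alphabet is a finite type \<open>'a\<close>, with \<open>k = CARD('a)\<close>, and a point of the
  probability simplex is an \<open>'a pmf\<close>.\<close>

text \<open>Half the \<open>l\<^sup>1\<close> distance of the mass functions.  It is stated for arbitrary pmfs because
  it is also applied to laws of vectors \<open>nat \<Rightarrow> 'a\<close>, which have finite support in an
  infinite type.\<close>

definition tv_dist :: "'b pmf \<Rightarrow> 'b pmf \<Rightarrow> real" where
  "tv_dist p q = (\<Sum>\<^sub>\<infinity>x. \<bar>pmf p x - pmf q x\<bar>) / 2"

lemma tv_dist_finite_type:
  fixes p q :: "'a::finite pmf"
  shows "tv_dist p q = 1 / 2 * (\<Sum>x\<in>UNIV. \<bar>pmf p x - pmf q x\<bar>)"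
  by (simp add: tv_dist_def)

text \<open>The convention \<open>0 log 0 = 0\<close> is automatic.  The value is meaningful only if \<open>P\<close> is
  positive wherever \<open>Q\<close> is; it is only used for \<open>P\<close> with full support.\<close>

definition rel_entropy :: "'a::finite pmf \<Rightarrow> 'a pmf \<Rightarrow> real" where
  "rel_entropy Q P = (\<Sum>x\<in>UNIV. pmf Q x * ln (pmf Q x / pmf P x))"

definition pairing :: "('a::finite \<Rightarrow> real) \<Rightarrow> 'a pmf \<Rightarrow> real" where
  "pairing g Q = (\<Sum>x\<in>UNIV. g x * pmf Q x)"

definition constraint_set ::
  "(nat \<Rightarrow> 'a::finite \<Rightarrow> real) \<Rightarrow> (nat \<Rightarrow> real) \<Rightarrow> nat \<Rightarrow> nat \<Rightarrow> 'a pmf set" where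
  "constraint_set g \<alpha> r0 r =
     {Q. (\<forall>j\<in>{1..r0}. pairing (g j) Q = \<alpha> j) \<and> (\<forall>j\<in>{r0<..r}. pairing (g j) Q \<ge> \<alpha> j)}"

definition window ::
  "(nat \<Rightarrow> 'a::finite \<Rightarrow> real) \<Rightarrow> (nat \<Rightarrow> real) \<Rightarrow> nat \<Rightarrow> nat \<Rightarrow> real \<Rightarrow> 'a pmf set" where
  "window g \<alpha> r0 r \<epsilon> =
     {Q. (\<forall>j\<in>{1..r0}. \<bar>pairing (g j) Q - \<alpha> j\<bar> \<le> \<epsilon>) \<and>
         (\<forall>j\<in>{r0<..r}. pairing (g j) Q \<ge> \<alpha> j - \<epsilon>)}"

definition c_rnd :: "(nat \<Rightarrow> 'a::finite \<Rightarrow> real) \<Rightarrow> nat \<Rightarrow> real" where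
  "c_rnd g r = real CARD('a) * (MAX j\<in>{1..r}. MAX x\<in>UNIV. \<bar>g j x\<bar>)"

text \<open>The minimiser is unique for \<open>P\<close> of full support and \<open>S\<close> nonempty, closed and convex.\<close>

definition I_proj :: "'a::finite pmf \<Rightarrow> 'a pmf set \<Rightarrow> 'a pmf" where
  "I_proj P S = arg_min_on (\<lambda>Q. rel_entropy Q P) S"

text \<open>The joint law of an i.i.d. family \<open>(X i)\<close>, \<open>i \<in> I\<close>, with common law \<open>P\<close>; coordinates
  outside \<open>I\<close> are \<open>undefined\<close>, as for \<^const>\<open>restrict\<close>.  The sample \<open>X 1, \<dots>, X N\<close> is realised as
  the coordinates under \<open>iid_law {1..N} P\<close>.\<close>

definition iid_law :: "nat set \<Rightarrow> 'a pmf \<Rightarrow> (nat \<Rightarrow> 'a) pmf" where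
  "iid_law I P = Pi_pmf I undefined (\<lambda>_. P)"

text \<open>The mixture of the point masses at \<open>x 1, \<dots>, x N\<close> with weights \<open>1/N\<close>, for \<open>N > 0\<close>.\<close>

definition empirical :: "nat \<Rightarrow> (nat \<Rightarrow> 'a) \<Rightarrow> 'a pmf" where
  "empirical N x = map_pmf x (pmf_of_set {1..N})"

lemma pmf_empirical:
  assumes "N > 0"
  shows "pmf (empirical N x) a = real (card {i\<in>{1..N}. x i = a}) / real N"
proof -
  have "{1..N} \<inter> x -` {a} = {i\<in>{1..N}. x i = a}"
    by auto
  with assms show ?thesis
    by (simp add: empirical_def pmf_map measure_pmf_of_set)
qed

definition types :: "nat \<Rightarrow> 'a::finite pmf set" where
  "types N = {Q. \<exists>n::'a \<Rightarrow> nat. (\<Sum>x\<in>UNIV. n x) = N \<and> (\<forall>x. pmf Q x = real (n x) / real N)}"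

definition cond_event :: "nat \<Rightarrow> 'a pmf set \<Rightarrow> (nat \<Rightarrow> 'a) set" where
  "cond_event N S = {x. empirical N x \<in> S}"

text \<open>\<^const>\<open>cond_pmf\<close> is the conditional law when the conditioning event has positive probability,
  and unspecified otherwise.\<close>

definition cond_law :: "nat \<Rightarrow> nat set \<Rightarrow> 'a pmf \<Rightarrow> 'a pmf set \<Rightarrow> (nat \<Rightarrow> 'a) pmf" where
  "cond_law N I P S = map_pmf (\<lambda>x. restrict x I) (cond_pmf (iid_law {1..N} P) (cond_event N S))"

definition bad_types :: "nat \<Rightarrow> 'a::finite pmf \<Rightarrow> 'a pmf set \<Rightarrow> real \<Rightarrow> 'a pmf set" where
  "bad_types N P S \<delta> = {Q \<in> S \<inter> types N. tv_dist Q (I_proj P S) > \<delta>}"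

definition bad_prob :: "nat \<Rightarrow> 'a::finite pmf \<Rightarrow> 'a pmf set \<Rightarrow> real \<Rightarrow> real" where
  "bad_prob N P S \<delta> =
     measure_pmf.prob (cond_pmf (iid_law {1..N} P) (cond_event N S))
       {x. empirical N x \<in> bad_types N P S \<delta>}"

end

theory Submission
  imports Defs "HOL-Probability.Hoeffding" "HOL-Combinatorics.Multiset_Permutations"
    "HOL-Real_Asymp.Real_Asymp"
begin

text \<open>Given its empirical measure \<open>Q\<close>, the sample is a uniformly random ordering of a fixed urn.
  Its coordinates in \<open>I\<close> are draws without replacement, which differ from \<open>Q\<^sup>m\<close> by at most the
  probability, bounded by \<open>m (m - 1) / 2N\<close>, that \<open>m\<close> draws with replacement collide; and \<open>Q\<^sup>m\<close> is within \<open>m \<delta>\<close> of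
  the product of the projection unless \<open>Q\<close> is a bad type.

  A bad type has relative entropy at least \<open>D + 2 \<delta>\<^sup>2\<close>, where \<open>D\<close> is the minimum over the window,
  by the Pythagorean inequality for the projection and Pinsker's inequality.  The method of types
  bounds the probability of all bad types by \<open>(N + 1)\<^sup>k exp (- N D - 2 N \<delta>\<^sup>2)\<close>, whereas the window
  contains a type of relative entropy at most \<open>D + O(1/N)\<close>, so the conditioning event has probability
  at least a constant times \<open>(N + 1)\<close> to the power \<open>- k\<close> times \<open>exp (- N D)\<close>.\<close>

subsection \<open>Total variation distance\<close>

text \<open>Since \<open>p\<close> and \<open>q\<close> both have mass 1, the positive and negative
  parts of their difference have equal mass, so half the sum is the excess of \<open>p\<close> on
  the set where it is larger. This turns estimates of the distance into estimates of event
  probabilities.\<close>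

lemma tv_dist_eq_prob_diff:
  "tv_dist p q = measure_pmf.prob p {x. pmf p x > pmf q x} - measure_pmf.prob q {x. pmf p x > pmf q x}"
proof -
  let ?A = "{x. pmf p x > pmf q x}"
  have on: "pmf r summable_on S" for r :: "'a pmf" and S
    using abs_summable_summable abs_summable_equivalent pmf_abs_summable by blast
  have inf: "infsum (pmf r) S = measure_pmf.prob r S" for r :: "'a pmf" and S
    by (metis infsetsum_infsum pmf_abs_summable measure_pmf_conv_infsetsum)
  have hs: "(pmf r has_sum measure_pmf.prob r S) S" for r :: "'a pmf" and S
    using has_sum_infsum[OF on[of r S]] by (simp add: inf)
  have diff: "((\<lambda>x. pmf r x - pmf s x) has_sum (measure_pmf.prob r S - measure_pmf.prob s S)) S"
    for r s :: "'a pmf" and S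
    using has_sum_add[OF hs[of r S], of "\<lambda>x. - pmf s x" "- measure_pmf.prob s S"] hs[of s S]
    by (simp add: has_sum_uminus)
  have 1: "((\<lambda>x. \<bar>pmf p x - pmf q x\<bar>) has_sum (measure_pmf.prob p ?A - measure_pmf.prob q ?A)) ?A"
  proof -
    have "((\<lambda>x. pmf p x - pmf q x) has_sum (measure_pmf.prob p ?A - measure_pmf.prob q ?A)) ?A"
      by (rule diff)
    then show ?thesis
      by (rule has_sum_cong[THEN iffD1, rotated]) auto
  qed
  have 2: "((\<lambda>x. \<bar>pmf p x - pmf q x\<bar>) has_sum (measure_pmf.prob q (-?A) - measure_pmf.prob p (-?A))) (-?A)"
  proof -
    have "((\<lambda>x. pmf q x - pmf p x) has_sum (measure_pmf.prob q (-?A) - measure_pmf.prob p (-?A))) (-?A)"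
      by (rule diff)
    then show ?thesis
      by (rule has_sum_cong[THEN iffD1, rotated]) auto
  qed
  have "infsum (\<lambda>x. \<bar>pmf p x - pmf q x\<bar>) UNIV =
    (measure_pmf.prob p ?A - measure_pmf.prob q ?A) + (measure_pmf.prob q (-?A) - measure_pmf.prob p (-?A))"
    using has_sum_Un_disjoint[OF 1 2] by (auto intro!: infsumI)
  moreover have "measure_pmf.prob r (-?A) = 1 - measure_pmf.prob r ?A" for r :: "'a pmf"
    using measure_pmf.prob_compl[of ?A r] by (simp add: Compl_eq_Diff_UNIV)
  ultimately show ?thesis unfolding tv_dist_def by simp
qed

lemma tv_dist_leI:
  assumes "\<And>A. measure_pmf.prob p A \<le> measure_pmf.prob q A + c"
  shows "tv_dist p q \<le> c"
  using assms[of "{x. pmf p x > pmf q x}"] by (simp add: tv_dist_eq_prob_diff)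

text \<open>No event has a larger excess than \<open>?S\<close>: dropping the points of
  \<open>A\<close> outside \<open>?S\<close> and adding the points of \<open>?S\<close> missing from
  \<open>A\<close> can only increase it.\<close>

lemma prob_le_tv_dist: "measure_pmf.prob p A \<le> measure_pmf.prob q A + tv_dist p q"
proof -
  let ?S = "{x. pmf p x > pmf q x}"
  have split: "measure_pmf.prob r U = measure_pmf.prob r (U \<inter> V) + measure_pmf.prob r (U - V)"
    for r :: "'a pmf" and U V
    by (subst measure_pmf.finite_measure_Union[symmetric]) (auto simp: Int_Diff_Un)
  have le: "measure_pmf.prob a U \<le> measure_pmf.prob b U" if "\<And>x. x \<in> U \<Longrightarrow> pmf a x \<le> pmf b x"
    for a b :: "'a pmf" and U
    unfolding measure_pmf_conv_infsetsum
    by (rule infsetsum_mono) (use that in \<open>auto intro: pmf_abs_summable\<close>)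
  have "measure_pmf.prob p (A - ?S) \<le> measure_pmf.prob q (A - ?S)"
    "measure_pmf.prob q (?S - A) \<le> measure_pmf.prob p (?S - A)"
    by (rule le; auto)+
  then show ?thesis
    using split[of p A ?S] split[of q A ?S] split[of p ?S A] split[of q ?S A]
    by (simp add: tv_dist_eq_prob_diff Int_commute)
qed

lemma tv_dist_nonneg: "0 \<le> tv_dist p q"
  using prob_le_tv_dist[of p UNIV q] by simp

lemma tv_dist_commute: "tv_dist p q = tv_dist q p"
  unfolding tv_dist_def by (simp add: abs_minus_commute)

lemma tv_dist_triangle: "tv_dist p r \<le> tv_dist p q + tv_dist q r"
proof (rule tv_dist_leI)
  show "measure_pmf.prob p A \<le> measure_pmf.prob r A + (tv_dist p q + tv_dist q r)" for A
    using prob_le_tv_dist[of p A q] prob_le_tv_dist[of q A r] by linarith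
qed

lemma abs_pmf_diff_le_tv_dist: "\<bar>pmf p x - pmf q x\<bar> \<le> tv_dist p q"
  using prob_le_tv_dist[of p "{x}" q] prob_le_tv_dist[of q "{x}" p]
  by (simp add: measure_pmf_single tv_dist_commute[of q p])

lemma tv_dist_map: "tv_dist (map_pmf f p) (map_pmf f q) \<le> tv_dist p q"
  by (rule tv_dist_leI) (simp add: measure_map_pmf prob_le_tv_dist)

lemma measure_bind_pmf:
  "measure_pmf.prob (bind_pmf p f) A = measure_pmf.expectation p (\<lambda>x. measure_pmf.prob (f x) A)"
  unfolding measure_pmf_bind
  by (rule measure_pmf.measure_bind[where N = "count_space UNIV"])
     (auto intro: measure_pmf_in_subprob_algebra)

lemma integrable_prob_pmf: "integrable (measure_pmf p) (\<lambda>x. measure_pmf.prob (f x) A)"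
  by (rule measure_pmf.integrable_const_bound[where B = 1]) auto

text \<open>\<open>B\<close> collects the mixture components without a useful estimate, where the
  trivial bound 1 is used. It becomes the event of a bad type and produces the summand
  \<open>bad_prob\<close>.\<close>

lemma tv_dist_bind_const:
  fixes f :: "'a \<Rightarrow> 'b pmf"
  assumes c: "\<And>x. x \<in> set_pmf p \<Longrightarrow> x \<notin> B \<Longrightarrow> tv_dist (f x) q \<le> c" and "c \<ge> 0"
  shows "tv_dist (bind_pmf p f) q \<le> c + measure_pmf.prob p B"
proof (rule tv_dist_leI)
  fix A :: "'b set"
  have int: "integrable (measure_pmf p) (indicator B :: 'a \<Rightarrow> real)"
    by (rule measure_pmf.integrable_const_bound[where B = 1]) (auto simp: indicator_def)
  have "measure_pmf.prob (bind_pmf p f) A = measure_pmf.expectation p (\<lambda>x. measure_pmf.prob (f x) A)"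
    by (rule measure_bind_pmf)
  also have "\<dots> \<le> measure_pmf.expectation p (\<lambda>x. measure_pmf.prob q A + c + indicator B x)"
  proof (rule integral_mono_AE)
    have "measure_pmf.prob (f x) A \<le> measure_pmf.prob q A + c + indicator B x"
      if x: "x \<in> set_pmf p" for x
    proof (cases "x \<in> B")
      case True
      then show ?thesis
        using \<open>c \<ge> 0\<close> measure_pmf.prob_le_1[of "f x" A] measure_nonneg[of q A]
        by (simp del: measure_nonneg measure_pmf.prob_le_1)
    next
      case False
      then show ?thesis using c[OF x] prob_le_tv_dist[of "f x" A q] by simp
    qed
    then show "AE x in p. measure_pmf.prob (f x) A \<le> measure_pmf.prob q A + c + indicator B x"
      by (simp add: AE_measure_pmf_iff)
  qed (intro integrable_prob_pmf Bochner_Integration.integrable_add int measure_pmf.integrable_const)+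
  also have "\<dots> = measure_pmf.prob q A + c + measure_pmf.prob p B"
    using int by (simp add: measure_pmf.prob_space)
  finally show "measure_pmf.prob (bind_pmf p f) A \<le> measure_pmf.prob q A + (c + measure_pmf.prob p B)"
    by simp
qed

lemma tv_dist_bind_cong:
  fixes f g :: "'a \<Rightarrow> 'b pmf"
  assumes c: "\<And>x. x \<in> set_pmf p \<Longrightarrow> tv_dist (f x) (g x) \<le> c"
  shows "tv_dist (bind_pmf p f) (bind_pmf p g) \<le> c"
proof (rule tv_dist_leI)
  fix A :: "'b set"
  have "measure_pmf.prob (bind_pmf p f) A = measure_pmf.expectation p (\<lambda>x. measure_pmf.prob (f x) A)"
    by (rule measure_bind_pmf)
  also have "\<dots> \<le> measure_pmf.expectation p (\<lambda>x. measure_pmf.prob (g x) A + c)"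
    by (rule integral_mono_AE)
       (auto simp: AE_measure_pmf_iff integrable_prob_pmf
       intro!: order_trans[OF prob_le_tv_dist add_left_mono] c)
  also have "\<dots> = measure_pmf.prob (bind_pmf p g) A + c"
    by (subst measure_bind_pmf, subst Bochner_Integration.integral_add) (auto simp: integrable_prob_pmf)
  finally show "measure_pmf.prob (bind_pmf p f) A \<le> measure_pmf.prob (bind_pmf p g) A + c" .
qed

text \<open>One coordinate is exchanged at a time, through the intermediate law
  \<open>pair_pmf c b\<close>.\<close>

lemma tv_dist_pair: "tv_dist (pair_pmf a b) (pair_pmf c d) \<le> tv_dist a c + tv_dist b d"
proof -
  have right: "tv_dist (pair_pmf r s) (pair_pmf r t) \<le> tv_dist s t"
    for r :: "'x pmf" and s t :: "'y pmf"
    unfolding pair_pmf_def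
    by (rule tv_dist_bind_cong) (use tv_dist_map in \<open>auto simp: map_pmf_def\<close>)
  have "tv_dist (pair_pmf a b) (pair_pmf c b) \<le> tv_dist a c"
    using order_trans[OF tv_dist_map right[of b a c], of "\<lambda>(x, y). (y, x)"]
    by (subst (1 2) pair_commute_pmf) simp
  then show ?thesis
    using tv_dist_triangle[of "pair_pmf a b" "pair_pmf c d" "pair_pmf c b"] right[of c b d] by linarith
qed

lemma tv_dist_iid_law:
  assumes "finite I"
  shows "tv_dist (iid_law I p) (iid_law I q) \<le> real (card I) * tv_dist p q"
  using assms
proof (induction I)
  case empty
  then show ?case by (simp add: iid_law_def tv_dist_def)
next
  case (insert i I)
  have "tv_dist (iid_law (insert i I) p) (iid_law (insert i I) q)
      \<le> tv_dist (pair_pmf p (iid_law I p)) (pair_pmf q (iid_law I q))"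
    unfolding iid_law_def Pi_pmf_insert[OF insert.hyps] by (rule tv_dist_map)
  also have "\<dots> \<le> tv_dist p q + tv_dist (iid_law I p) (iid_law I q)"
    by (rule tv_dist_pair)
  finally show ?case using insert by (simp add: algebra_simps)
qed

subsection \<open>Sampling with and without replacement\<close>

text \<open>The sets missed by \<open>j\<close> and by \<open>k\<close> have the same size, so the
  matching of \<open>j i\<close> with \<open>k i\<close> extends to a permutation. Composition with
  it moves one injection to any other.\<close>

lemma injections_extend_permutes:
  assumes S: "finite S" and I: "I \<subseteq> S"
    and j: "j ` I \<subseteq> S" "inj_on j I" and k: "k ` I \<subseteq> S" "inj_on k I"
  shows "\<exists>\<tau>. \<tau> permutes S \<and> (\<forall>i\<in>I. \<tau> (j i) = k i)"
proof -
  have fin: "finite (j ` I)" "finite (k ` I)"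
    using S j k by (auto intro: finite_subset)
  have "card (S - j ` I) = card (S - k ` I)"
    using j k fin by (simp add: card_Diff_subset card_image)
  then obtain h where h: "bij_betw h (S - j ` I) (S - k ` I)"
    using S by (meson finite_Diff finite_same_card_bij)
  have jk: "bij_betw (k \<circ> inv_into I j) (j ` I) (k ` I)"
    using j k
    by (intro bij_betw_trans[of "inv_into I j" "j ` I" I] bij_betw_inv_into bij_betw_imageI) auto
  define \<tau> where "\<tau> x = (if x \<in> j ` I then k (inv_into I j x) else if x \<in> S then h x else x)" for x
  have "bij_betw \<tau> (j ` I \<union> (S - j ` I)) (k ` I \<union> (S - k ` I))"
  proof (rule bij_betw_combine)
    show "bij_betw \<tau> (j ` I) (k ` I)"
      using jk by (rule bij_betw_cong[THEN iffD1, rotated]) (simp add: \<tau>_def)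
    show "bij_betw \<tau> (S - j ` I) (S - k ` I)"
      using h by (rule bij_betw_cong[THEN iffD1, rotated]) (auto simp: \<tau>_def)
  qed auto
  then have "bij_betw \<tau> S S"
    using j k by (simp add: Un_absorb1)
  moreover have "\<tau> x = x" if "x \<notin> S" for x
    using that j by (auto simp: \<tau>_def)
  ultimately have "\<tau> permutes S" by (rule bij_imp_permutes)
  moreover have "\<tau> (j i) = k i" if "i \<in> I" for i
    using that j by (simp add: \<tau>_def inv_into_f_f)
  ultimately show ?thesis by blast
qed

lemma pmf_const_eq_pmf_of_set:
  assumes F: "finite F" "set_pmf p \<subseteq> F" and c: "\<And>x. x \<in> F \<Longrightarrow> pmf p x = c"
  shows "p = pmf_of_set F"
proof -
  have "F \<noteq> {}" using F(2) set_pmf_not_empty[of p] by blast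
  have "1 = sum (pmf p) F" using sum_pmf_eq_1[OF F] by simp
  also have "\<dots> = real (card F) * c" using c by simp
  finally have "c = 1 / card F" using F \<open>F \<noteq> {}\<close> by (simp add: field_simps)
  then show ?thesis
    using F c \<open>F \<noteq> {}\<close> by (intro pmf_eqI) (auto simp: indicator_def pmf_eq_0_set_pmf)
qed

lemma map_restrict_permutations:
  assumes S: "finite S" and I: "I \<subseteq> S"
  shows "map_pmf (\<lambda>\<sigma>. restrict \<sigma> I) (pmf_of_set {\<sigma>. \<sigma> permutes S})
       = pmf_of_set {j \<in> I \<rightarrow>\<^sub>E S. inj_on j I}" (is "?U = pmf_of_set ?F")
proof -
  have fin: "finite {\<sigma>. \<sigma> permutes S}" using S by (rule finite_permutations)
  have ne: "{\<sigma>. \<sigma> permutes S} \<noteq> {}" using permutes_id by blast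
  have finF: "finite ?F"
  proof (rule finite_subset)
    show "finite (I \<rightarrow>\<^sub>E S)" using S finite_subset[OF I S] by (simp add: finite_PiE)
  qed auto
  have sub: "set_pmf ?U \<subseteq> ?F"
  proof -
    have "restrict \<sigma> I \<in> ?F" if "\<sigma> permutes S" for \<sigma>
      using that I permutes_in_image[OF that] permutes_inj_on[OF that, of I]
      by (auto simp: inj_on_restrict_eq)
    then show ?thesis
      unfolding set_map_pmf set_pmf_of_set[OF ne fin] by blast
  qed
  let ?C = "\<lambda>j. {\<sigma>. \<sigma> permutes S} \<inter> (\<lambda>\<sigma>. restrict \<sigma> I) -` {j}"
  \<comment> \<open>Left composition with \<tau> maps the fibre over \<open>j\<close> injectively
    into the fibre over \<open>k\<close>; by symmetry all fibres of the restriction map have the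
    same size.\<close>
  have le: "card (?C j) \<le> card (?C k)" if jk: "j \<in> ?F" "k \<in> ?F" for j k
  proof -
    have "j ` I \<subseteq> S" "inj_on j I" "k ` I \<subseteq> S" "inj_on k I"
      using jk by (auto simp: PiE_iff)
    from injections_extend_permutes[OF S I this]
    obtain \<tau> where \<tau>: "\<tau> permutes S" "\<forall>i\<in>I. \<tau> (j i) = k i" by blast
    have "inj_on ((\<circ>) \<tau>) (?C j)"
      using fun.inj_map[OF permutes_inj[OF \<tau>(1)]] by (rule inj_on_subset) simp
    moreover have "((\<circ>) \<tau>) ` ?C j \<subseteq> ?C k"
    proof (rule image_subsetI)
      fix \<sigma> assume "\<sigma> \<in> ?C j"
      then have \<sigma>: "\<sigma> permutes S" "j = restrict \<sigma> I" by auto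
      have "restrict (\<tau> \<circ> \<sigma>) I i = k i" for i
        using \<tau>(2) \<sigma>(2) PiE_arb[of k I "\<lambda>_. S" i] jk(2) by (cases "i \<in> I") auto
      then have "restrict (\<tau> \<circ> \<sigma>) I = k" by (rule ext)
      then show "\<tau> \<circ> \<sigma> \<in> ?C k"
        using permutes_compose[OF \<sigma>(1) \<tau>(1)] by blast
    qed
    ultimately show ?thesis by (rule card_inj_on_le[OF _ _ finite_Int[OF disjI1[OF fin]]])
  qed
  obtain j0 where j0: "j0 \<in> ?F" using sub set_pmf_not_empty[of ?U] by (meson all_not_in_conv subsetD)
  have "pmf ?U j = card (?C j0) / card {\<sigma>. \<sigma> permutes S}" if "j \<in> ?F" for j
    using le[OF that j0] le[OF j0 that] unfolding pmf_map measure_pmf_of_set[OF ne fin] by simp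
  then show ?thesis by (rule pmf_const_eq_pmf_of_set[OF finF sub])
qed

text \<open>The law on \<open>F\<close> is the law on \<open>G\<close> conditioned on
  \<open>F\<close>, and conditioning raises a probability by at most the mass of the
  complement.\<close>

lemma tv_dist_pmf_of_set_subset:
  assumes "finite G" "F \<subseteq> G" "F \<noteq> {}"
  shows "tv_dist (pmf_of_set F) (pmf_of_set G) \<le> measure_pmf.prob (pmf_of_set G) (- F)"
proof (rule tv_dist_leI)
  fix A
  have F: "finite F" and G: "G \<noteq> {}" using assms finite_subset by auto
  let ?f = "real (card F)" and ?g = "real (card G)"
  have pos: "?f > 0" "?f \<le> ?g" using assms F card_mono by (auto simp: card_gt_0_iff)
  have "real (card (F \<inter> A)) / ?f - real (card (F \<inter> A)) / ?g
      = real (card (F \<inter> A)) / ?f * (1 - ?f / ?g)"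
    using pos by (simp add: field_simps)
  also have "\<dots> \<le> 1 * (1 - ?f / ?g)"
    using pos F card_mono[of F "F \<inter> A"] by (intro mult_right_mono) auto
  finally have "real (card (F \<inter> A)) / ?f \<le> real (card (F \<inter> A)) / ?g + (1 - ?f / ?g)" by simp
  also have "real (card (F \<inter> A)) / ?g \<le> real (card (G \<inter> A)) / ?g"
    using assms by (intro divide_right_mono) (auto intro!: card_mono)
  also have "1 - ?f / ?g = measure_pmf.prob (pmf_of_set G) (- F)"
    using assms F G pos by (simp add: measure_pmf_of_set Diff_eq[symmetric] card_Diff_subset
        card_mono of_nat_diff diff_divide_distrib)
  finally show "measure_pmf.prob (pmf_of_set F) A
      \<le> measure_pmf.prob (pmf_of_set G) A + measure_pmf.prob (pmf_of_set G) (- F)"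
    using assms F G by (simp add: measure_pmf_of_set)
qed

lemma iid_law_pmf_of_set:
  assumes "finite I" "finite S" "S \<noteq> {}"
  shows "iid_law I (pmf_of_set S) = pmf_of_set (I \<rightarrow>\<^sub>E S)"
proof -
  have "PiE_dflt I undefined (\<lambda>_. S) = I \<rightarrow>\<^sub>E S"
    by (auto simp: PiE_dflt_def PiE_def extensional_def)
  then show ?thesis
    unfolding iid_law_def using Pi_pmf_of_set[of I "\<lambda>_. S" undefined] assms by simp
qed

text \<open>A new draw coincides with one of the \<open>card I\<close> earlier ones with probability
  at most \<open>card I / card S\<close>, and the increments 0, 1, 2, ... add up to m (m - 1) /
  2.\<close>

lemma prob_collision:
  fixes S :: "'a set"
  assumes S: "finite S" "S \<noteq> {}" and "finite I"
  shows "measure_pmf.prob (iid_law I (pmf_of_set S)) {j. \<not> inj_on j I}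
      \<le> real (card I) * (real (card I) - 1) / (2 * real (card S))"
  using \<open>finite I\<close>
proof (induction I)
  case empty
  then show ?case by simp
next
  case (insert i I)
  let ?u = "pmf_of_set S" and ?V = "iid_law I (pmf_of_set S)"
  let ?N = "real (card S)" and ?m = "real (card I)"
  have N: "?N > 0" using S by (simp add: card_gt_0_iff)
  have "{(y, f :: nat \<Rightarrow> 'a). \<not> inj_on (f(i := y)) (insert i I)}
      \<subseteq> snd -` {f. \<not> inj_on f I} \<union> {(y, f). y \<in> f ` I}"
  proof -
    have "y \<in> f ` I" if a: "\<not> inj_on (f(i := y)) (insert i I)" "inj_on f I" for y and f :: "nat \<Rightarrow> 'a"
    proof -
      have "inj_on (f(i := y)) I \<longleftrightarrow> inj_on f I" "(f(i := y)) ` I = f ` I"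
        using insert.hyps by (auto intro!: inj_on_cong)
      moreover have "I - {i} = I" using insert.hyps by auto
      ultimately show ?thesis
        using a by (simp add: inj_on_insert)
    qed
    then show ?thesis
      by (simp only: subset_iff split_paired_All Un_iff vimage_eq mem_Collect_eq prod.case snd_conv) blast
  qed
  then have "measure_pmf.prob (iid_law (insert i I) ?u) {j. \<not> inj_on j (insert i I)}
      \<le> measure_pmf.prob (pair_pmf ?u ?V) (snd -` {f. \<not> inj_on f I} \<union> {(y, f). y \<in> f ` I})"
    unfolding iid_law_def Pi_pmf_insert[OF insert.hyps] measure_map_pmf
    by (intro measure_pmf.finite_measure_mono) auto
  also have "\<dots> \<le> measure_pmf.prob (pair_pmf ?u ?V) (snd -` {f. \<not> inj_on f I})
      + measure_pmf.prob (pair_pmf ?u ?V) {(y, f). y \<in> f ` I}"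
    by (intro measure_Un_le) auto
  also have "measure_pmf.prob (pair_pmf ?u ?V) (snd -` {f. \<not> inj_on f I})
      = measure_pmf.prob ?V {f. \<not> inj_on f I}"
    using measure_map_pmf[of snd "pair_pmf ?u ?V" "{f. \<not> inj_on f I}"] by (simp only: map_snd_pair_pmf)
  also have "measure_pmf.prob (pair_pmf ?u ?V) {(y, f). y \<in> f ` I}
      = measure_pmf.expectation ?V (\<lambda>f. measure_pmf.prob ?u (f ` I))"
  proof -
    have "pair_pmf ?u ?V = bind_pmf ?V (\<lambda>f. map_pmf (\<lambda>y. (y, f)) ?u)"
      unfolding pair_pmf_def map_pmf_def by (rule bind_commute_pmf)
    moreover have "(\<lambda>y. (y, f)) -` {(y, f). y \<in> f ` I} = f ` I" for f :: "nat \<Rightarrow> 'a"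
      by auto
    ultimately show ?thesis by (simp only: measure_bind_pmf measure_map_pmf)
  qed
  also have "\<dots> \<le> measure_pmf.expectation ?V (\<lambda>f. ?m / ?N)"
  proof (rule integral_mono)
    fix f :: "nat \<Rightarrow> 'a"
    have "card (S \<inter> f ` I) \<le> card (f ` I)" using insert.hyps by (intro card_mono) auto
    also have "\<dots> \<le> card I" using insert.hyps by (intro card_image_le)
    finally show "measure_pmf.prob ?u (f ` I) \<le> ?m / ?N"
      using S by (simp add: measure_pmf_of_set divide_right_mono)
  qed (auto intro!: measure_pmf.integrable_const_bound[where B = 1])
  also have "\<dots> = ?m / ?N" by simp
  finally show ?case
    using insert.IH insert.hyps N by (simp add: field_simps)
qed

text \<open>The restricted permutation is a uniform injection, that is, independent draws
  conditioned on having no collision; so only the collision probability is lost.\<close>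

lemma tv_dist_sampling_without_replacement:
  assumes S: "finite S" "I \<subseteq> S" "S \<noteq> {}"
  shows "tv_dist (map_pmf (\<lambda>\<sigma>. restrict \<sigma> I) (pmf_of_set {\<sigma>. \<sigma> permutes S})) (iid_law I (pmf_of_set S))
      \<le> real (card I) * (real (card I) - 1) / (2 * real (card S))"
proof -
  let ?F = "{j \<in> I \<rightarrow>\<^sub>E S. inj_on j I}"
  have I: "finite I" using S finite_subset by auto
  have "restrict id I \<in> ?F" using S by (auto simp: inj_on_def restrict_def PiE_def extensional_def)
  then have "?F \<noteq> {}" by blast
  then have "tv_dist (pmf_of_set ?F) (pmf_of_set (I \<rightarrow>\<^sub>E S))
      \<le> measure_pmf.prob (pmf_of_set (I \<rightarrow>\<^sub>E S)) (- ?F)"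
    using I S by (intro tv_dist_pmf_of_set_subset finite_PiE) auto
  also have "\<dots> \<le> measure_pmf.prob (pmf_of_set (I \<rightarrow>\<^sub>E S)) {j. \<not> inj_on j I}"
    using I S by (subst (1 2) measure_pmf_of_set)
      (auto simp: PiE_eq_empty_iff finite_PiE intro!: divide_right_mono card_mono)
  also have "\<dots> \<le> real (card I) * (real (card I) - 1) / (2 * real (card S))"
    using prob_collision[OF S(1,3) I] iid_law_pmf_of_set[OF I S(1,3)] by simp
  finally show ?thesis
    using map_restrict_permutations[OF S(1,2)] iid_law_pmf_of_set[OF I S(1,3)] by simp
qed

section \<open>Exchangeability and resampling from the empirical measure\<close>

lemma empirical_comp_permutes:
  assumes "\<sigma> permutes {1..N}" "N > 0"
  shows "empirical N (x \<circ> \<sigma>) = empirical N x"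
proof -
  have "map_pmf \<sigma> (pmf_of_set {1..N}) = pmf_of_set {1..N}"
    using assms by (intro map_pmf_of_set_bij_betw permutes_imp_bij) auto
  then show ?thesis
    unfolding empirical_def by (simp flip: pmf.map_comp)
qed

lemma iid_law_comp_permutes:
  assumes "\<sigma> permutes S" "finite S"
  shows "map_pmf (\<lambda>x. x \<circ> \<sigma>) (iid_law S P) = iid_law S P"
  unfolding iid_law_def
  using assms permutes_not_in[OF assms(1)]
  by (intro Pi_pmf_bij_betw[symmetric] permutes_imp_bij) auto

lemma iid_law_empirical:
  assumes "finite I"
  shows "iid_law I (empirical N x) = map_pmf (\<lambda>j. restrict (x \<circ> j) I) (iid_law I (pmf_of_set {1..N}))"
proof -
  \<comment> \<open>\<open>Pi_pmf_map\<close> sends the default value along \<open>x\<close>, so the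
    product is formed with default \<open>x undefined\<close>; restricting to \<open>I\<close> puts
    \<open>undefined\<close> back outside \<open>I\<close>.\<close>
  have "iid_law I (empirical N x) = map_pmf (\<lambda>f. restrict f I)
      (Pi_pmf I (x undefined) (\<lambda>_. map_pmf x (pmf_of_set {1..N})))"
    unfolding iid_law_def empirical_def restrict_def by (rule Pi_pmf_default_swap[OF assms, symmetric])
  also have "Pi_pmf I (x undefined) (\<lambda>_. map_pmf x (pmf_of_set {1..N}))
      = map_pmf (\<lambda>j. x \<circ> j) (iid_law I (pmf_of_set {1..N}))"
    unfolding iid_law_def by (rule Pi_pmf_map[OF assms refl])
  finally show ?thesis by (simp only: pmf.map_comp) (simp only: o_def)
qed

text \<open>The conditioned sample is exchangeable, so its law on \<open>I\<close> is that of \<open>x \<circ> \<sigma>\<close> on \<open>I\<close> for an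
  independent uniform permutation \<open>\<sigma>\<close>.  Replacing \<open>\<sigma>\<close> on \<open>I\<close> by independent uniform indices
  turns this, for each \<open>x\<close>, into the product of its empirical measure.\<close>

lemma tv_dist_cond_law:
  assumes N: "N > 0" and I: "I \<subseteq> {1..N}"
    and ne: "set_pmf (iid_law {1..N} P) \<inter> cond_event N S \<noteq> {}"
    and good: "\<And>x. empirical N x \<in> S \<Longrightarrow> x \<notin> B \<Longrightarrow> tv_dist (empirical N x) Q \<le> \<delta>" and "\<delta> \<ge> 0"
  shows "tv_dist (cond_law N I P S) (iid_law I Q)
      \<le> real (card I) * \<delta> + real (card I) * (real (card I) - 1) / (2 * real N)
        + measure_pmf.prob (cond_pmf (iid_law {1..N} P) (cond_event N S)) B"
proof -
  let ?m = "real (card I)"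
  let ?\<mu> = "cond_pmf (iid_law {1..N} P) (cond_event N S)"
  let ?\<Sigma> = "{\<sigma>. \<sigma> permutes {1..N}}"
  have finI: "finite I" using I finite_subset by auto
  have fin: "finite ?\<Sigma>" by (rule finite_permutations) simp
  have ne\<Sigma>: "?\<Sigma> \<noteq> {}" using permutes_id by blast
  have inv: "map_pmf (\<lambda>x. x \<circ> \<sigma>) ?\<mu> = ?\<mu>" if \<sigma>: "\<sigma> permutes {1..N}" for \<sigma>
  proof -
    have "(\<lambda>x. x \<circ> \<sigma>) -` cond_event N S = cond_event N S"
      unfolding cond_event_def vimage_def mem_Collect_eq empirical_comp_permutes[OF \<sigma> N] ..
    with cond_map_pmf[of "iid_law {1..N} P" "\<lambda>x. x \<circ> \<sigma>" "cond_event N S"] ne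
    show ?thesis by (simp only: iid_law_comp_permutes[OF \<sigma> finite_atLeastAtMost] simp_thms)
  qed
  have "cond_law N I P S = bind_pmf (pmf_of_set ?\<Sigma>)
      (\<lambda>\<sigma>. map_pmf (\<lambda>x. restrict x I) (map_pmf (\<lambda>x. x \<circ> \<sigma>) ?\<mu>))"
    using fin ne\<Sigma> inv
    by (subst bind_pmf_cong[OF refl, where g = "\<lambda>_. map_pmf (\<lambda>x. restrict x I) ?\<mu>"])
       (simp_all add: cond_law_def)
  \<comment> \<open>The two independent choices are interchanged, so that the sample
    \<open>x\<close> is fixed and only the permutation is random.\<close>
  also have "\<dots> = bind_pmf ?\<mu> (\<lambda>x. map_pmf (\<lambda>\<sigma>. restrict (x \<circ> \<sigma>) I) (pmf_of_set ?\<Sigma>))"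
    unfolding map_pmf_def bind_assoc_pmf bind_return_pmf by (rule bind_commute_pmf)
  also have "\<dots> = bind_pmf ?\<mu> (\<lambda>x. map_pmf (\<lambda>j. restrict (x \<circ> j) I)
      (map_pmf (\<lambda>\<sigma>. restrict \<sigma> I) (pmf_of_set ?\<Sigma>)))"
  proof (rule arg_cong[where f = "bind_pmf ?\<mu>"], rule ext)
    fix x :: "nat \<Rightarrow> 'a"
    have "(\<lambda>j. restrict (x \<circ> j) I) \<circ> (\<lambda>\<sigma>. restrict \<sigma> I) = (\<lambda>\<sigma>. restrict (x \<circ> \<sigma>) I)"
      by (simp add: fun_eq_iff restrict_def)
    then show "map_pmf (\<lambda>\<sigma>. restrict (x \<circ> \<sigma>) I) (pmf_of_set ?\<Sigma>)
        = map_pmf (\<lambda>j. restrict (x \<circ> j) I) (map_pmf (\<lambda>\<sigma>. restrict \<sigma> I) (pmf_of_set ?\<Sigma>))"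
      by (simp only: pmf.map_comp)
  qed
  finally have eq: "cond_law N I P S = \<dots>" .
  show ?thesis
    unfolding eq
  proof (rule tv_dist_bind_const)
    fix x assume x: "x \<in> set_pmf ?\<mu>" "x \<notin> B"
    let ?L = "map_pmf (\<lambda>j. restrict (x \<circ> j) I) (map_pmf (\<lambda>\<sigma>. restrict \<sigma> I) (pmf_of_set ?\<Sigma>))"
    have "tv_dist ?L (iid_law I (empirical N x)) \<le> ?m * (?m - 1) / (2 * real N)"
      unfolding iid_law_empirical[OF finI]
      using N tv_dist_sampling_without_replacement[OF finite_atLeastAtMost I]
      by (intro order_trans[OF tv_dist_map]) simp
    moreover have "tv_dist (iid_law I (empirical N x)) (iid_law I Q) \<le> ?m * \<delta>"
      using good x ne
      by (intro order_trans[OF tv_dist_iid_law[OF finI] mult_left_mono]) (auto simp: cond_event_def)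
    ultimately show "tv_dist ?L (iid_law I Q) \<le> ?m * \<delta> + ?m * (?m - 1) / (2 * real N)"
      using tv_dist_triangle[of ?L "iid_law I Q" "iid_law I (empirical N x)"] by linarith
  next
    \<comment> \<open>The factor \<open>?m - 1\<close> is a real difference, equal to -1 for empty
      \<open>I\<close>; the product is still nonnegative.\<close>
    have "?m * (?m - 1) \<ge> 0" by (cases "card I") auto
    then show "0 \<le> ?m * \<delta> + ?m * (?m - 1) / (2 * real N)" using \<open>\<delta> \<ge> 0\<close> by simp
  qed
qed

subsection \<open>The method of types\<close>

definition occurrences :: "nat \<Rightarrow> (nat \<Rightarrow> 'a) \<Rightarrow> 'a \<Rightarrow> nat" where
  "occurrences N x a = card {i \<in> {1..N}. x i = a}"

text \<open>The type class of the counts \<open>n\<close>. Extensional functions make it finite and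
  match the value \<open>undefined\<close> that samples of \<open>iid_law\<close> take outside
  \<open>{1..N}\<close>.\<close>

definition freq_class :: "nat \<Rightarrow> ('a::finite \<Rightarrow> nat) \<Rightarrow> (nat \<Rightarrow> 'a) set" where
  "freq_class N n = {x \<in> {1..N} \<rightarrow>\<^sub>E UNIV. occurrences N x = n}"

lemma finite_freq_class: "finite (freq_class N n)"
  unfolding freq_class_def
  by (rule finite_subset[OF _ finite_PiE[of "{1..N}" "\<lambda>_. UNIV"]]) auto

lemma sum_occurrences: "(\<Sum>a\<in>UNIV. occurrences N x (a :: 'a::finite)) = N"
  using sum.group[of "{1..N}" "UNIV :: 'a set" x "\<lambda>_. 1 :: nat"]
  by (simp add: occurrences_def)

lemma pmf_iid_law:
  fixes x :: "nat \<Rightarrow> 'a::finite"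
  assumes "x \<in> {1..N} \<rightarrow>\<^sub>E UNIV"
  shows "pmf (iid_law {1..N} P) x = (\<Prod>a\<in>UNIV. pmf P a ^ occurrences N x a)"
proof -
  have "pmf (iid_law {1..N} P) x = (\<Prod>i\<in>{1..N}. pmf P (x i))"
    unfolding iid_law_def using assms by (intro pmf_Pi') (auto simp: PiE_def extensional_def)
  also have "\<dots> = (\<Prod>a\<in>UNIV. \<Prod>i\<in>{i \<in> {1..N}. x i = a}. pmf P (x i))"
    by (rule prod.group[symmetric]) auto
  also have "\<dots> = (\<Prod>a\<in>UNIV. pmf P a ^ occurrences N x a)"
    by (simp add: occurrences_def)
  finally show ?thesis .
qed

text \<open>The multinomial coefficient, kept free of division: the class is in bijection with the
  orderings of the multiset containing \<open>n a\<close> copies of each \<open>a\<close>.\<close>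

lemma card_freq_class:
  fixes n :: "'a::finite \<Rightarrow> nat"
  assumes "sum n UNIV = N"
  shows "card (freq_class N n) * (\<Prod>a\<in>UNIV. fact (n a)) = fact N"
proof -
  define M where "M = (\<Sum>a\<in>UNIV. replicate_mset (n a) a)"
  have count: "count M a = n a" for a
  proof -
    have "count M a = (\<Sum>b\<in>UNIV. if b = a then n b else 0)"
      unfolding M_def count_sum by (intro sum.cong) auto
    then show ?thesis by simp
  qed
  have size: "size M = N"
    using assms by (simp add: M_def)
  have occ: "count (mset (map x [1..<Suc N])) a = occurrences N x a" for x :: "nat \<Rightarrow> 'a" and a
  proof -
    have "count (mset (map x [1..<Suc N])) a = length (filter (\<lambda>i. x i = a) [1..<Suc N])"
    proof -
      have "count (mset xs) a = length (filter (\<lambda>y. y = a) xs)" for xs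
        by (induction xs) auto
      then show ?thesis by (simp only: filter_map length_map o_def)
    qed
    also have "\<dots> = card (set (filter (\<lambda>i. x i = a) [1..<Suc N]))"
      by (rule distinct_card[symmetric]) simp
    also have "set (filter (\<lambda>i. x i = a) [1..<Suc N]) = {i \<in> {1..N}. x i = a}" by auto
    finally show ?thesis by (simp add: occurrences_def)
  qed
  \<comment> \<open>List positions start at 0 and sample indices at 1, hence
    \<open>i - 1\<close>.\<close>
  have "bij_betw (\<lambda>x. map x [1..<Suc N]) (freq_class N n) (permutations_of_multiset M)"
  proof (rule bij_betw_byWitness[where f' = "\<lambda>xs. restrict (\<lambda>i. xs ! (i - 1)) {1..N}"])
    show "\<forall>x\<in>freq_class N n. restrict (\<lambda>i. map x [1..<Suc N] ! (i - 1)) {1..N} = x"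
      by (auto simp: freq_class_def PiE_def extensional_def fun_eq_iff simp del: upt_Suc)
    show len: "\<forall>xs\<in>permutations_of_multiset M. map (restrict (\<lambda>i. xs ! (i - 1)) {1..N}) [1..<Suc N] = xs"
      using size by (auto intro!: nth_equalityI simp: permutations_of_multiset_def
        simp del: upt_Suc simp flip: size_mset)
    show "(\<lambda>x. map x [1..<Suc N]) ` freq_class N n \<subseteq> permutations_of_multiset M"
    proof clarify
      fix x assume "x \<in> freq_class N n"
      then have "occurrences N x a = n a" for a by (simp add: freq_class_def)
      then show "map x [1..<Suc N] \<in> permutations_of_multiset M"
        unfolding permutations_of_multiset_def multiset_eq_iff mem_Collect_eq occ count by blast
    qed
    show "(\<lambda>xs. restrict (\<lambda>i. xs ! (i - 1)) {1..N}) ` permutations_of_multiset M \<subseteq> freq_class N n"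
    proof clarify
      fix xs assume xs: "xs \<in> permutations_of_multiset M"
      have "occurrences N (restrict (\<lambda>i. xs ! (i - 1)) {1..N}) a = n a" for a
        using len xs by (subst occ[symmetric]) (simp add: count permutations_of_multiset_def del: upt_Suc mset_map)
      then show "restrict (\<lambda>i. xs ! (i - 1)) {1..N} \<in> freq_class N n"
        by (auto simp: freq_class_def)
    qed
  qed
  then have "card (freq_class N n) = card (permutations_of_multiset M)"
    by (rule bij_betw_same_card)
  \<comment> \<open>Letters with count 0 are missing from \<open>set_mset M\<close> but contribute
    the factor \<open>fact 0 = 1\<close>.\<close>
  moreover have "(\<Prod>a\<in>UNIV. fact (n a)) = (\<Prod>a\<in>set_mset M. fact (count M a) :: nat)"
    unfolding count by (rule prod.mono_neutral_right) (auto simp: not_in_iff count)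
  ultimately show ?thesis
    using card_permutations_of_multiset_aux[of M] size by simp
qed

text \<open>Compares the two factorials through the factors between them: for m \<le> n these are n
  - m factors, each at most \<open>n\<close>; for m > n they are m - n factors, each larger than
  \<open>n\<close>.\<close>

lemma power_mult_fact_le: "n ^ m * fact n \<le> fact m * (n ^ n :: nat)"
proof (cases "m \<le> n")
  case True
  then show ?thesis
  proof (induction rule: inc_induct)
    case base
    then show ?case by simp
  next
    case (step m)
    have "n * (n ^ m * fact n) \<le> Suc m * (fact m * n ^ n)"
      using step.IH by (simp add: algebra_simps)
    also have "\<dots> \<le> n * (fact m * n ^ n)"
      using step.hyps by (intro mult_right_mono) auto
    finally show ?case using step.hyps by simp
  qed
next
  case False
  then have "n \<le> m" by simp
  then show ?thesis
  proof (induction rule: dec_induct)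
    case base
    then show ?case by simp
  next
    case (step m)
    have "n * (n ^ m * fact n) \<le> n * (fact m * n ^ n)"
      using step.IH by (rule mult_left_mono) simp
    also have "\<dots> \<le> Suc m * (fact m * n ^ n)"
      using step.hyps by (intro mult_right_mono) auto
    finally show ?case by (simp add: algebra_simps)
  qed
qed

lemma pmf_iid_law_freq_class:
  assumes "x \<in> freq_class N n"
  shows "pmf (iid_law {1..N} P) x = (\<Prod>a\<in>UNIV. pmf P a ^ n a)"
  using assms pmf_iid_law[of x N P] by (auto simp: freq_class_def)

lemma prob_freq_class:
  "measure_pmf.prob (iid_law {1..N} P) (freq_class N n)
    = real (card (freq_class N n)) * (\<Prod>a\<in>UNIV. pmf P a ^ n a)"
  using sum.cong[OF refl, of "freq_class N n" "pmf (iid_law {1..N} P)" "\<lambda>_. \<Prod>a\<in>UNIV. pmf P a ^ n a"]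
  by (simp only: measure_measure_pmf_finite[OF finite_freq_class] sum_constant pmf_iid_law_freq_class simp_thms)

text \<open>The ratio of the two probabilities is a product over the letters of the ratios compared
  in \<open>power_mult_fact_le\<close>, so a law favours its own type class.\<close>

lemma prob_freq_class_max:
  fixes n :: "'a::finite \<Rightarrow> nat"
  assumes "N > 0" and n: "sum n UNIV = N" and m: "sum m UNIV = N"
    and Q: "\<And>a. pmf Q a = real (n a) / real N"
  shows "measure_pmf.prob (iid_law {1..N} Q) (freq_class N m)
    \<le> measure_pmf.prob (iid_law {1..N} Q) (freq_class N n)"
proof -
  \<comment> \<open>The exponents total \<open>N\<close>, so all classes share the denominator
    \<open>N ^ N\<close> and the comparison is one of natural numbers.\<close>
  have eq: "(\<Prod>a\<in>UNIV. pmf Q a ^ l a) = real (\<Prod>a\<in>UNIV. n a ^ l a) / real N ^ N"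
    if "sum l UNIV = N" for l :: "'a \<Rightarrow> nat"
    using that by (simp add: Q power_divide prod_dividef flip: power_sum)
  define cn cm fn fm pn pm where "cn = card (freq_class N n)" and "cm = card (freq_class N m)"
    and "fn = (\<Prod>a\<in>UNIV. fact (n a) :: nat)" and "fm = (\<Prod>a\<in>UNIV. fact (m a) :: nat)"
    and "pn = (\<Prod>a\<in>UNIV. n a ^ n a)" and "pm = (\<Prod>a\<in>UNIV. n a ^ m a)"
  have f: "fn > 0" "fm > 0" by (auto simp: fn_def fm_def intro!: prod_pos)
  have c: "cm * fm = cn * fn"
    using card_freq_class[OF n] card_freq_class[OF m] by (simp add: cn_def cm_def fn_def fm_def)
  have le: "pm * fn \<le> fm * pn"
    unfolding pm_def fn_def fm_def pn_def prod.distrib[symmetric]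
    by (rule prod_mono) (auto simp: power_mult_fact_le)
  have "(cm * pm) * (fm * fn) = (cm * fm) * (pm * fn)" by (simp add: ac_simps)
  also have "\<dots> \<le> (cm * fm) * (fm * pn)" using le by (rule mult_le_mono2)
  also have "\<dots> = (cn * pn) * (fm * fn)" unfolding c by (simp add: ac_simps)
  finally have "cm * pm \<le> cn * pn" using f by simp
  then have "real (cm * pm) \<le> real (cn * pn)" by (rule of_nat_mono)
  then have "real (cm * pm) / real N ^ N \<le> real (cn * pn) / real N ^ N"
    by (rule divide_right_mono) simp
  then show ?thesis
    unfolding prob_freq_class eq[OF n] eq[OF m]
    by (simp add: cn_def cm_def pn_def pm_def)
qed

lemma card_bounded_functions:
  "card ((UNIV :: 'a::finite set) \<rightarrow>\<^sub>E {..N :: nat}) = (N + 1) ^ CARD('a)"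
  by (simp add: card_PiE)

lemma set_iid_law: "set_pmf (iid_law {1..N} P) \<subseteq> {1..N} \<rightarrow>\<^sub>E UNIV"
  unfolding iid_law_def
  using set_Pi_pmf_subset[of "{1..N}" undefined "\<lambda>_. P"] by (auto simp: PiE_def extensional_def)

lemma le_sum_nat: "(n :: 'a::finite \<Rightarrow> nat) a \<le> sum n UNIV"
  by (rule member_le_sum) auto

text \<open>Pigeonhole: the classes cover the support, there are at most
  \<open>(N + 1) ^ CARD('a)\<close> of them, and that of \<open>n\<close> is the most
  likely.\<close>

lemma prob_freq_class_ge:
  fixes n :: "'a::finite \<Rightarrow> nat"
  assumes "N > 0" and n: "sum n UNIV = N" and Q: "\<And>a. pmf Q a = real (n a) / real N"
  shows "1 / (real N + 1) ^ CARD('a) \<le> measure_pmf.prob (iid_law {1..N} Q) (freq_class N n)"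
proof -
  let ?p = "measure_pmf.prob (iid_law {1..N} Q)"
  let ?T = "{m \<in> (UNIV :: 'a set) \<rightarrow>\<^sub>E {..N}. sum m UNIV = N}"
  have finE: "finite ((UNIV :: 'a set) \<rightarrow>\<^sub>E {..N})" by (intro finite_PiE) auto
  then have fin: "finite ?T" by simp
  have "set_pmf (iid_law {1..N} Q) \<subseteq> (\<Union>m\<in>?T. freq_class N m)"
  proof
    fix x assume x: "x \<in> set_pmf (iid_law {1..N} Q)"
    have "occurrences N x \<in> ?T"
      using sum_occurrences[of N x] le_sum_nat[of "occurrences N x"] by auto
    moreover have "x \<in> freq_class N (occurrences N x)"
      using x set_iid_law[of N Q] by (auto simp: freq_class_def)
    ultimately show "x \<in> (\<Union>m\<in>?T. freq_class N m)" by blast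
  qed
  then have "1 = ?p (\<Union>m\<in>?T. freq_class N m)"
    by (simp add: measure_pmf.prob_eq_1 AE_measure_pmf_iff subset_iff)
  also have "\<dots> \<le> (\<Sum>m\<in>?T. ?p (freq_class N m))"
    using fin by (intro measure_UNION_le) auto
  also have "\<dots> \<le> (\<Sum>m\<in>?T. ?p (freq_class N n))"
    using prob_freq_class_max[OF assms(1) n _ Q] by (intro sum_mono) auto
  also have "\<dots> \<le> real ((N + 1) ^ CARD('a)) * ?p (freq_class N n)"
    using card_mono[OF finE, of ?T] unfolding card_bounded_functions
    by (simp only: sum_constant) (intro mult_right_mono of_nat_mono, auto)
  finally show ?thesis by (simp add: field_simps add.commute)
qed

lemma empirical_eq_iff:
  assumes "N > 0" and Q: "\<And>a. pmf Q a = real (n a) / real N"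
  shows "empirical N x = Q \<longleftrightarrow> occurrences N x = n"
  using assms by (auto simp: pmf_eq_iff pmf_empirical occurrences_def fun_eq_iff)

lemma prob_empirical_eq:
  assumes "N > 0" and Q: "\<And>a. pmf Q a = real (n a) / real N"
  shows "measure_pmf.prob (iid_law {1..N} P) {x. empirical N x = Q}
    = measure_pmf.prob (iid_law {1..N} P) (freq_class N n)"
  using set_iid_law[of N P]
  by (intro measure_prob_cong_0) (auto simp: empirical_eq_iff[OF assms] freq_class_def pmf_eq_0_set_pmf)

text \<open>Change of measure: on the type class of \<open>Q\<close> the likelihood ratio of
  \<open>P\<close> to \<open>Q\<close> is constant, equal to the exponential factor.\<close>

lemma prob_empirical_eq_rel_entropy:
  fixes P :: "'a::finite pmf"
  assumes "N > 0" and P: "\<And>a. pmf P a > 0" and Q: "\<And>a. pmf Q a = real (n a) / real N"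
  shows "measure_pmf.prob (iid_law {1..N} P) {x. empirical N x = Q}
    = measure_pmf.prob (iid_law {1..N} Q) (freq_class N n) * exp (- real N * rel_entropy Q P)"
proof -
  \<comment> \<open>Letters absent from \<open>Q\<close> are treated apart: for them both powers are
    1 and the logarithm carries weight 0.\<close>
  have "pmf P a ^ n a = pmf Q a ^ n a * exp (- real N * (pmf Q a * ln (pmf Q a / pmf P a)))" for a
  proof (cases "n a = 0")
    case False
    then have "pmf Q a > 0" using Q \<open>N > 0\<close> by simp
    then have "pmf P a = pmf Q a * exp (- ln (pmf Q a / pmf P a))"
      using P[of a] by (simp add: exp_minus)
    then have "pmf P a ^ n a = pmf Q a ^ n a * exp (real (n a) * - ln (pmf Q a / pmf P a))"
      by (metis exp_of_nat_mult power_mult_distrib)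
    also have "real (n a) * - ln (pmf Q a / pmf P a) = - real N * (pmf Q a * ln (pmf Q a / pmf P a))"
      using Q[of a] \<open>N > 0\<close> by simp
    finally show ?thesis .
  qed (simp add: Q)
  then have "(\<Prod>a\<in>UNIV. pmf P a ^ n a)
      = (\<Prod>a\<in>UNIV. pmf Q a ^ n a * exp (- real N * (pmf Q a * ln (pmf Q a / pmf P a))))" by simp
  also have "\<dots> = (\<Prod>a\<in>UNIV. pmf Q a ^ n a) * exp (- real N * rel_entropy Q P)"
    by (simp add: prod.distrib rel_entropy_def sum_distrib_left flip: exp_sum)
  finally show ?thesis
    unfolding prob_empirical_eq[OF assms(1) Q] prob_freq_class by simp
qed

lemma prob_empirical_eq_le:
  fixes P :: "'a::finite pmf"
  assumes "N > 0" and P: "\<And>a. pmf P a > 0" and "Q \<in> types N"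
  shows "measure_pmf.prob (iid_law {1..N} P) {x. empirical N x = Q} \<le> exp (- real N * rel_entropy Q P)"
proof -
  obtain n where n: "\<And>a. pmf Q a = real (n a) / real N"
    using assms by (auto simp: types_def)
  show ?thesis
    unfolding prob_empirical_eq_rel_entropy[OF assms(1) P n]
    by (simp add: mult_left_le_one_le)
qed

lemma prob_empirical_eq_ge:
  fixes P :: "'a::finite pmf"
  assumes "N > 0" and P: "\<And>a. pmf P a > 0" and "Q \<in> types N"
  shows "exp (- real N * rel_entropy Q P) / (real N + 1) ^ CARD('a)
    \<le> measure_pmf.prob (iid_law {1..N} P) {x. empirical N x = Q}"
proof -
  obtain n where n: "sum n UNIV = N" "\<And>a. pmf Q a = real (n a) / real N"
    using assms by (auto simp: types_def)
  have "1 / (real N + 1) ^ CARD('a) * exp (- real N * rel_entropy Q P)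
      \<le> measure_pmf.prob (iid_law {1..N} Q) (freq_class N n) * exp (- real N * rel_entropy Q P)"
    by (intro mult_right_mono prob_freq_class_ge[OF assms(1) n]) simp
  then show ?thesis
    unfolding prob_empirical_eq_rel_entropy[OF assms(1) P n(2)] by simp
qed

lemma empirical_in_types:
  assumes "N > 0"
  shows "empirical N x \<in> types N"
  unfolding types_def using assms sum_occurrences[of N x]
  by (auto intro!: exI[of _ "occurrences N x"] simp: pmf_empirical occurrences_def)

lemma types_bound:
  shows "finite (types N :: 'a::finite pmf set)" "card (types N :: 'a pmf set) \<le> (N + 1) ^ CARD('a)"
proof -
  let ?E = "(UNIV :: 'a set) \<rightarrow>\<^sub>E {..N}"
  let ?F = "\<lambda>n. SOME Q :: 'a pmf. \<forall>a. pmf Q a = real (n a) / real N"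
  have sub: "types N \<subseteq> ?F ` ?E"
  proof
    fix Q :: "'a pmf" assume "Q \<in> types N"
    then obtain n where n: "sum n UNIV = N" "\<forall>a. pmf Q a = real (n a) / real N"
      by (auto simp: types_def)
    have "?F n = Q" using n(2) by (intro some_equality) (auto intro: pmf_eqI)
    moreover have "n \<in> ?E" using le_sum_nat[of n] n(1) by auto
    ultimately show "Q \<in> ?F ` ?E" by blast
  qed
  have fin: "finite ?E" by (intro finite_PiE) auto
  show "finite (types N :: 'a pmf set)" using sub fin finite_surj by blast
  show "card (types N :: 'a pmf set) \<le> (N + 1) ^ CARD('a)"
    using surj_card_le[OF fin sub] by (simp only: card_bounded_functions)
qed

lemma prob_empirical_in_le:
  fixes P :: "'a::finite pmf"
  assumes "N > 0" and P: "\<And>a. pmf P a > 0"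
    and d: "\<And>Q. Q \<in> S \<Longrightarrow> Q \<in> types N \<Longrightarrow> d \<le> rel_entropy Q P"
  shows "measure_pmf.prob (iid_law {1..N} P) {x. empirical N x \<in> S}
    \<le> (real N + 1) ^ CARD('a) * exp (- real N * d)"
proof -
  let ?p = "measure_pmf.prob (iid_law {1..N} P)"
  have fin: "finite (S \<inter> types N)" using types_bound(1) by blast
  have "?p {x. empirical N x \<in> S} = ?p (\<Union>Q\<in>S \<inter> types N. {x. empirical N x = Q})"
    using empirical_in_types[OF assms(1)] by (intro arg_cong[where f = ?p]) auto
  also have "\<dots> \<le> (\<Sum>Q\<in>S \<inter> types N. ?p {x. empirical N x = Q})"
    using fin by (intro measure_UNION_le) auto
  also have "\<dots> \<le> (\<Sum>Q\<in>S \<inter> types N. exp (- real N * d))"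
    using assms(1) d
    by (intro sum_mono order_trans[OF prob_empirical_eq_le[OF assms(1) P]]) (auto intro!: mult_left_mono)
  also have "\<dots> \<le> real ((N + 1) ^ CARD('a)) * exp (- real N * d)"
    using order_trans[OF card_mono[OF types_bound(1)] types_bound(2), of "S \<inter> types N"]
    by (simp only: sum_constant) (intro mult_right_mono of_nat_mono, auto)
  finally show ?thesis by (simp add: add.commute)
qed

subsection \<open>Relative entropy and its projections\<close>

lemma exists_pmf_with_masses:
  fixes f :: "'a::finite \<Rightarrow> real"
  assumes "\<And>a. 0 \<le> f a" "sum f UNIV = 1"
  shows "\<exists>q. \<forall>a. pmf q a = f a"
proof -
  have "(\<integral>\<^sup>+a. ennreal (f a) \<partial>count_space UNIV) = 1"
    using assms by (simp add: nn_integral_count_space_finite sum_ennreal)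
  then show ?thesis
    using assms(1) pmf_embed_pmf[of f] by blast
qed

lemma sum_pmf_UNIV: "(\<Sum>a\<in>UNIV. pmf p (a :: 'a::finite)) = 1"
  by (rule sum_pmf_eq_1) auto

lemma mult_ln_ge:
  fixes q w :: real
  assumes "q \<ge> 0" "w > 0"
  shows "q - w \<le> q * ln (q / w)"
proof (cases "q = 0")
  case False
  with assms have q: "q > 0" by simp
  have "ln (w / q) \<le> w / q - 1" using assms q by (intro ln_le_minus_one) simp
  then have "q * ln (w / q) \<le> w - q" using mult_left_mono[of _ _ q] q by (fastforce simp: field_simps)
  then show ?thesis using assms q by (simp add: ln_div algebra_simps)
qed (use assms in simp)

text \<open>The Donsker-Varadhan lower bound with the test function \<open>4 t\<close> times the indicator of
  \<open>{q > p}\<close>, where \<open>t\<close> is the total variation distance; its cumulant generating function is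
  controlled by Hoeffding's lemma.\<close>

lemma pinsker:
  fixes p q :: "'a::finite pmf"
  assumes p: "\<And>a. pmf p a > 0"
  shows "2 * (tv_dist q p)\<^sup>2 \<le> rel_entropy q p"
proof -
  define A where "A = {a. pmf q a > pmf p a}"
  define t where "t = tv_dist q p"
  \<comment> \<open>This value of \<open>h\<close> maximises \<open>h * t - h\<^sup>2 / 8\<close>,
    and the maximum is \<open>2 * t\<^sup>2\<close>.\<close>
  define h where "h = 4 * t"
  define pA qA where "pA = (\<Sum>a\<in>A. pmf p a)" and "qA = (\<Sum>a\<in>A. pmf q a)"
  have t: "t = qA - pA"
    unfolding t_def tv_dist_eq_prob_diff A_def[symmetric] pA_def qA_def
    by (simp add: measure_measure_pmf_finite)
  have h: "h \<ge> 0" using tv_dist_nonneg[of q p] by (simp add: h_def t_def)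
  have pA: "pA \<ge> 0" by (simp add: pA_def sum_nonneg)
  \<comment> \<open>The normalising constant of the exponentially tilted law \<open>w\<close>, that
    is, the mean of \<open>exp (h * indicator A a)\<close> under \<open>p\<close>.\<close>
  define Z where "Z = 1 + pA * (exp h - 1)"
  have Z: "Z > 0" using pA h by (simp add: Z_def add_pos_nonneg)
  define w where "w a = pmf p a * exp (h * indicator A a) / Z" for a
  have w: "w a > 0" for a using p Z by (simp add: w_def)
  have "(\<Sum>a\<in>UNIV. pmf p a * exp (h * indicator A a))
      = (\<Sum>a\<in>UNIV. pmf p a + indicator A a * pmf p a * (exp h - 1))"
    by (intro sum.cong) (auto simp: indicator_def algebra_simps)
  also have "\<dots> = Z"
    unfolding sum.distrib sum_distrib_right[symmetric] sum_pmf_UNIV Z_def pA_def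
    by (simp add: sum.If_cases indicator_def if_distrib cong: if_cong)
  finally have "sum w UNIV = 1" using Z by (simp add: w_def flip: sum_divide_distrib)
  \<comment> \<open>Gibbs' inequality for \<open>q\<close> against \<open>w\<close>, by summing
    \<open>mult_ln_ge\<close>.\<close>
  then have "0 = (\<Sum>a\<in>UNIV. pmf q a - w a)" by (simp add: sum_subtractf sum_pmf_UNIV)
  also have "\<dots> \<le> (\<Sum>a\<in>UNIV. pmf q a * ln (pmf q a / w a))"
    using w by (intro sum_mono mult_ln_ge) auto
  also have "\<dots> = (\<Sum>a\<in>UNIV. pmf q a * ln (pmf q a / pmf p a) - h * (indicator A a * pmf q a) + pmf q a * ln Z)"
  proof (rule sum.cong)
    fix a
    have ln: "ln (pmf q a / w a) = ln (pmf q a / pmf p a) - h * indicator A a + ln Z" if "pmf q a > 0"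
      using that p[of a] Z w[of a] unfolding w_def by (simp add: ln_div ln_mult)
    show "pmf q a * ln (pmf q a / w a)
        = pmf q a * ln (pmf q a / pmf p a) - h * (indicator A a * pmf q a) + pmf q a * ln Z"
    proof (cases "pmf q a = 0")
      case False
      then have "pmf q a > 0" by (simp add: less_le)
      from ln[OF this] show ?thesis by (simp only:) (simp add: algebra_simps)
    qed simp
  qed simp
  also have "\<dots> = rel_entropy q p - h * qA + ln Z"
    unfolding sum.distrib sum_subtractf sum_distrib_left[symmetric] sum_distrib_right[symmetric]
      sum_pmf_UNIV rel_entropy_def qA_def
    by (simp add: sum.If_cases indicator_def if_distrib cong: if_cong)
  finally have "h * qA - ln Z \<le> rel_entropy q p" by simp
  moreover have "- h * pA + ln Z \<le> h\<^sup>2 / 8"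
    unfolding Z_def using h pA by (rule Hoeffdings_lemma_aux)
  ultimately have "h * t - h\<^sup>2 / 8 \<le> rel_entropy q p" by (simp add: t algebra_simps)
  then show ?thesis by (simp add: h_def t_def power2_eq_square)
qed

lemma rel_entropy_chain:
  fixes p q P :: "'a::finite pmf"
  assumes "\<And>a. pmf p a > 0" "\<And>a. pmf P a > 0"
  shows "rel_entropy q P = rel_entropy q p + (\<Sum>a\<in>UNIV. pmf q a * ln (pmf p a / pmf P a))"
  unfolding rel_entropy_def sum.distrib[symmetric]
proof (rule sum.cong)
  fix a
  have "ln (pmf q a / pmf P a) = ln (pmf q a / pmf p a) + ln (pmf p a / pmf P a)" if "pmf q a > 0"
    using that assms[of a] by (simp add: ln_div)
  then show "pmf q a * ln (pmf q a / pmf P a)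
      = pmf q a * ln (pmf q a / pmf p a) + pmf q a * ln (pmf p a / pmf P a)"
    by (cases "pmf q a = 0") (simp_all add: algebra_simps pmf_nonneg less_le)
qed simp

text \<open>From ln x \<le> x - 1; the linear terms left over sum to 0 because both laws have mass
  1.\<close>

lemma rel_entropy_le_chi_square:
  fixes p q :: "'a::finite pmf"
  assumes p: "\<And>a. pmf p a > 0"
  shows "rel_entropy q p \<le> (\<Sum>a\<in>UNIV. (pmf q a - pmf p a)\<^sup>2 / pmf p a)"
proof -
  have "rel_entropy q p \<le> (\<Sum>a\<in>UNIV. pmf q a * (pmf q a / pmf p a - 1))"
    unfolding rel_entropy_def
  proof (intro sum_mono)
    fix a
    show "pmf q a * ln (pmf q a / pmf p a) \<le> pmf q a * (pmf q a / pmf p a - 1)"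
      using p[of a]
      by (cases "pmf q a = 0") (auto intro!: mult_left_mono ln_le_minus_one simp: less_le)
  qed
  also have "\<dots> = (\<Sum>a\<in>UNIV. (pmf q a - pmf p a)\<^sup>2 / pmf p a + (pmf q a - pmf p a))"
  proof (rule sum.cong)
    fix a
    show "pmf q a * (pmf q a / pmf p a - 1) = (pmf q a - pmf p a)\<^sup>2 / pmf p a + (pmf q a - pmf p a)"
      using p[of a] by (simp add: field_simps power2_eq_square)
  qed simp
  also have "\<dots> = (\<Sum>a\<in>UNIV. (pmf q a - pmf p a)\<^sup>2 / pmf p a)"
    by (simp add: sum.distrib sum_subtractf sum_pmf_UNIV)
  finally show ?thesis .
qed

text \<open>First-order expansion at \<open>p\<close> with a quadratic remainder. It serves both for
  the directional derivative in the Pythagorean inequality and for the cost of rounding to a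
  type.\<close>

lemma rel_entropy_expansion_le:
  fixes p q P :: "'a::finite pmf"
  assumes p: "\<And>a. pmf p a > 0" and P: "\<And>a. pmf P a > 0"
  shows "rel_entropy q P \<le> rel_entropy p P + (\<Sum>a\<in>UNIV. (pmf q a - pmf p a) * ln (pmf p a / pmf P a))
    + (\<Sum>a\<in>UNIV. (pmf q a - pmf p a)\<^sup>2 / pmf p a)"
  using rel_entropy_chain[OF p P, of q] rel_entropy_le_chi_square[OF p, of q]
  by (simp add: left_diff_distrib sum_subtractf rel_entropy_def)

text \<open>The quantity \<open>B\<close> in the proof is the derivative of the relative entropy at
  \<open>p\<close> in the direction of \<open>q\<close>. Minimality along the segment makes it
  nonnegative, and the chain rule turns this into the inequality.\<close>

lemma rel_entropy_pythagoras:
  fixes p q P :: "'a::finite pmf"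
  assumes p: "\<And>a. pmf p a > 0" and P: "\<And>a. pmf P a > 0"
    and min: "\<And>t r. 0 < t \<Longrightarrow> t \<le> 1 \<Longrightarrow> (\<And>a. pmf r a = pmf p a + t * (pmf q a - pmf p a))
      \<Longrightarrow> rel_entropy p P \<le> rel_entropy r P"
  shows "rel_entropy q p + rel_entropy p P \<le> rel_entropy q P"
proof -
  define B where "B = (\<Sum>a\<in>UNIV. (pmf q a - pmf p a) * ln (pmf p a / pmf P a))"
  define X where "X = (\<Sum>a\<in>UNIV. (pmf q a - pmf p a)\<^sup>2 / pmf p a)"
  have X: "X \<ge> 0" unfolding X_def by (intro sum_nonneg) simp
  have dir: "0 \<le> B + t * X" if t: "0 < t" "t \<le> 1" for t
  proof -
    have "0 \<le> pmf p a + t * (pmf q a - pmf p a)" for a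
    proof -
      have "pmf p a + t * (pmf q a - pmf p a) = (1 - t) * pmf p a + t * pmf q a"
        by (simp add: algebra_simps)
      then show ?thesis using t by simp
    qed
    moreover have "(\<Sum>a\<in>UNIV. pmf p a + t * (pmf q a - pmf p a)) = 1"
      by (simp add: sum.distrib sum_subtractf sum_pmf_UNIV flip: sum_distrib_left)
    ultimately obtain r where r: "\<And>a. pmf r a = pmf p a + t * (pmf q a - pmf p a)"
      using exists_pmf_with_masses[of "\<lambda>a. pmf p a + t * (pmf q a - pmf p a)"] by auto
    have "rel_entropy p P \<le> rel_entropy r P" using t r by (rule min)
    also have "\<dots> \<le> rel_entropy p P + t * B + t\<^sup>2 * X"
      using rel_entropy_expansion_le[OF p P, of r]
      by (simp add: r B_def X_def power_mult_distrib sum_distrib_left mult.assoc)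
    finally have "0 \<le> t * (B + t * X)" by (simp add: algebra_simps power2_eq_square)
    then show ?thesis using t by (simp add: zero_le_mult_iff)
  qed
  have "B \<ge> 0"
  proof (rule field_le_epsilon)
    fix e :: real assume e: "e > 0"
    \<comment> \<open>Chosen to make \<open>t * X\<close> at most \<open>e\<close>;
      \<open>X + 1\<close> keeps the denominator positive when \<open>X\<close> is 0.\<close>
    define t where "t = min 1 (e / (X + 1))"
    have t: "0 < t" "t \<le> 1" "t \<le> e / (X + 1)" using e X by (auto simp: t_def)
    have "t * X \<le> e / (X + 1) * X" using t X by (intro mult_right_mono)
    also have "\<dots> \<le> e" using e X by (simp add: field_simps)
    finally show "0 \<le> B + e" using dir[OF t(1,2)] by simp
  qed
  then show ?thesis
    using rel_entropy_chain[OF p P, of q]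
    by (simp add: B_def left_diff_distrib sum_subtractf rel_entropy_def)
qed

section \<open>Rounding to types and the geometry of the windows\<close>

lemma exists_type_near:
  fixes Q :: "'a::finite pmf"
  assumes "N > 0"
  shows "\<exists>R\<in>types N. \<forall>a. \<bar>pmf R a - pmf Q a\<bar> \<le> 1 / real N"
proof -
  \<comment> \<open>All counts are rounded down. The deficit against \<open>N\<close> is at most the
    number of letters, so it is filled by raising the counts on a set \<open>A\<close> by one, each
    staying within 1 of its target.\<close>
  define f where "f a = nat \<lfloor>real N * pmf Q a\<rfloor>" for a
  have f: "real (f a) \<le> real N * pmf Q a" "real N * pmf Q a < real (f a) + 1" for a
    unfolding f_def by (simp_all add: of_nat_nat)
  have total: "(\<Sum>a\<in>UNIV. real N * pmf Q a) = real N"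
    by (simp add: sum_pmf_UNIV flip: sum_distrib_left)
  have "(\<Sum>a\<in>UNIV. real (f a)) \<le> real N"
    using sum_mono[of UNIV "\<lambda>a. real (f a)" "\<lambda>a. real N * pmf Q a"] f total by simp
  then have le: "sum f UNIV \<le> N" by (simp flip: of_nat_sum)
  have "real N \<le> (\<Sum>a\<in>UNIV. real (f a) + 1)"
    using sum_mono[of UNIV "\<lambda>a. real N * pmf Q a" "\<lambda>a. real (f a) + 1"] f total
    by (simp add: less_imp_le)
  also have "\<dots> = real (sum f UNIV + CARD('a))" by (simp add: sum.distrib)
  finally have "N - sum f UNIV \<le> CARD('a)" by linarith
  then obtain A :: "'a set" where A: "card A = N - sum f UNIV"
    using obtain_subset_with_card_n by metis
  define n where "n a = f a + (if a \<in> A then 1 else 0)" for a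
  have n: "sum n UNIV = N"
    using A le by (simp add: n_def sum.distrib sum.If_cases)
  have "(\<Sum>a\<in>UNIV. real (n a) / real N) = 1"
    using n \<open>N > 0\<close> by (simp flip: sum_divide_distrib of_nat_sum)
  then obtain R where R: "\<And>a. pmf R a = real (n a) / real N"
    using exists_pmf_with_masses[of "\<lambda>a. real (n a) / real N"] by auto
  have "\<bar>pmf R a - pmf Q a\<bar> \<le> 1 / real N" for a
  proof -
    have "\<bar>real (n a) - real N * pmf Q a\<bar> \<le> 1" using f[of a] by (auto simp: n_def)
    then have "\<bar>real (n a) - real N * pmf Q a\<bar> / real N \<le> 1 / real N"
      by (rule divide_right_mono) simp
    moreover have "\<bar>real (n a) - real N * pmf Q a\<bar> / real N = \<bar>(real (n a) - real N * pmf Q a) / real N\<bar>"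
      by simp
    moreover have "(real (n a) - real N * pmf Q a) / real N = pmf R a - pmf Q a"
      using \<open>N > 0\<close> by (simp add: R diff_divide_distrib)
    ultimately show ?thesis by simp
  qed
  moreover have "R \<in> types N" unfolding types_def using n R by blast
  ultimately show ?thesis by blast
qed

lemma c_rnd_nonneg:
  fixes g :: "nat \<Rightarrow> 'a::finite \<Rightarrow> real"
  assumes "r \<ge> 1"
  shows "0 \<le> c_rnd g r"
proof -
  have "0 \<le> \<bar>g 1 undefined\<bar>" by simp
  also have "\<dots> \<le> (MAX x\<in>UNIV. \<bar>g 1 x\<bar>)" by (rule Max_ge) auto
  also have "\<dots> \<le> (MAX j\<in>{1..r}. MAX x\<in>UNIV. \<bar>g j x\<bar>)" using assms by (intro Max_ge) auto
  finally show ?thesis unfolding c_rnd_def by simp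
qed

text \<open>Each of the \<open>CARD('a)\<close> coordinates contributes at most the largest absolute
  value times \<open>d\<close>, which explains the form of \<open>c_rnd\<close>: rounding with error
  1/N shifts a constraint by at most \<open>c_rnd g r / N\<close>.\<close>

lemma pairing_diff_le:
  fixes g :: "nat \<Rightarrow> 'a::finite \<Rightarrow> real"
  assumes j: "j \<in> {1..r}" and d: "\<And>a. \<bar>pmf R a - pmf Q a\<bar> \<le> d"
  shows "\<bar>pairing (g j) R - pairing (g j) Q\<bar> \<le> c_rnd g r * d"
proof -
  let ?M = "MAX j\<in>{1..r}. MAX x\<in>UNIV. \<bar>g j x\<bar>"
  have M: "\<bar>g j a\<bar> \<le> ?M" for a
  proof -
    have "\<bar>g j a\<bar> \<le> (MAX x\<in>UNIV. \<bar>g j x\<bar>)" by (rule Max_ge) auto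
    also have "\<dots> \<le> ?M" using j by (intro Max_ge) auto
    finally show ?thesis .
  qed
  have "\<bar>pairing (g j) R - pairing (g j) Q\<bar> = \<bar>\<Sum>a\<in>UNIV. g j a * (pmf R a - pmf Q a)\<bar>"
    by (simp add: pairing_def right_diff_distrib sum_subtractf)
  also have "\<dots> \<le> (\<Sum>a\<in>UNIV. \<bar>g j a * (pmf R a - pmf Q a)\<bar>)" by (rule sum_abs)
  also have "\<dots> \<le> (\<Sum>a\<in>(UNIV :: 'a set). ?M * d)"
    unfolding abs_mult
    using M d order_trans[OF abs_ge_zero M] by (intro sum_mono mult_mono) auto
  also have "\<dots> = c_rnd g r * d" by (simp add: c_rnd_def)
  finally show ?thesis .
qed

lemma window_enlarge:
  fixes g :: "nat \<Rightarrow> 'a::finite \<Rightarrow> real"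
  assumes "r0 \<le> r" and Q: "Q \<in> window g \<alpha> r0 r e" and d: "\<And>a. \<bar>pmf R a - pmf Q a\<bar> \<le> d"
  shows "R \<in> window g \<alpha> r0 r (e + c_rnd g r * d)"
proof -
  have close: "\<bar>pairing (g j) R - pairing (g j) Q\<bar> \<le> c_rnd g r * d" if "j \<in> {1..r}" for j
    by (rule pairing_diff_le[OF that d])
  show ?thesis
    unfolding window_def mem_Collect_eq
  proof (intro conjI ballI)
    fix j assume j: "j \<in> {1..r0}"
    then have "\<bar>pairing (g j) Q - \<alpha> j\<bar> \<le> e" using Q unfolding window_def by blast
    moreover have "j \<in> {1..r}" using j \<open>r0 \<le> r\<close> by simp
    ultimately show "\<bar>pairing (g j) R - \<alpha> j\<bar> \<le> e + c_rnd g r * d"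
      using close[of j] by linarith
  next
    fix j assume j: "j \<in> {r0<..r}"
    then have "\<alpha> j - e \<le> pairing (g j) Q" using Q unfolding window_def by blast
    moreover have "j \<in> {1..r}" using j by simp
    ultimately show "\<alpha> j - (e + c_rnd g r * d) \<le> pairing (g j) R"
      using close[of j] by linarith
  qed
qed

lemma window_zero: "window g \<alpha> r0 r 0 = constraint_set g \<alpha> r0 r"
  by (auto simp: window_def constraint_set_def)

lemma window_mono: "e \<le> e' \<Longrightarrow> window g \<alpha> r0 r e \<subseteq> window g \<alpha> r0 r e'"
  unfolding window_def by force

lemma window_convex:
  fixes g :: "nat \<Rightarrow> 'a::finite \<Rightarrow> real"
  assumes p: "p \<in> window g \<alpha> r0 r e" and q: "q \<in> window g \<alpha> r0 r e" and t: "0 \<le> t" "t \<le> 1"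
    and R: "\<And>a. pmf R a = pmf p a + t * (pmf q a - pmf p a)"
  shows "R \<in> window g \<alpha> r0 r e"
proof -
  have eq: "pairing h R = (1 - t) * pairing h p + t * pairing h q" for h :: "'a \<Rightarrow> real"
    unfolding pairing_def sum_distrib_left sum.distrib[symmetric]
    by (intro sum.cong) (simp_all add: R algebra_simps)
  have conv: "l \<le> (1 - t) * x + t * y" if "l \<le> x" "l \<le> y" for l x y :: real
    using convex_bound_le[of "- x" "- l" "- y" "1 - t" t] that t by simp
  have conv': "(1 - t) * x + t * y \<le> u" if "x \<le> u" "y \<le> u" for u x y :: real
    using convex_bound_le[of x u y "1 - t" t] that t by simp
  have "\<bar>(1 - t) * x + t * y - l\<bar> \<le> e" if "\<bar>x - l\<bar> \<le> e" "\<bar>y - l\<bar> \<le> e" for x y l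
    using that conv[of "l - e" x y] conv'[of x "l + e" y] unfolding abs_diff_le_iff by blast
  then show ?thesis
    using p q conv unfolding window_def mem_Collect_eq eq by blast
qed

section \<open>Existence of the projection\<close>

lemma continuous_on_mult_ln:
  fixes c :: real
  assumes "c > 0"
  shows "continuous_on {0..} (\<lambda>y. y * ln (y / c))"
proof (rule continuous_on_eq_continuous_within[THEN iffD2], rule ballI)
  fix y :: real assume "y \<in> {0..}"
  then consider "y = 0" | "y > 0" by fastforce
  then show "continuous (at y within {0..}) (\<lambda>y. y * ln (y / c))"
  proof cases
    case 1
    have "((\<lambda>y. y * ln (y / c)) \<longlongrightarrow> 0) (at_right 0)" using assms by real_asymp
    then show ?thesis using 1 by (simp add: continuous_within at_within_Ici_at_right)
  next
    case 2
    then show ?thesis using assms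
      by (intro continuous_intros) auto
  qed
qed

text \<open>Compactness: the mass vectors of the window form a closed bounded subset of
  \<open>real ^ 'a\<close>, on which the relative entropy is continuous up to the boundary.
  \<open>I_proj\<close> selects some minimiser, so both claims follow once one exists.\<close>

lemma I_proj_window:
  fixes P :: "'a::finite pmf"
  assumes P: "\<And>a. pmf P a > 0" and ne: "window g \<alpha> r0 r e \<noteq> {}"
  shows "I_proj P (window g \<alpha> r0 r e) \<in> window g \<alpha> r0 r e"
    and "Q \<in> window g \<alpha> r0 r e \<Longrightarrow> rel_entropy (I_proj P (window g \<alpha> r0 r e)) P \<le> rel_entropy Q P"
proof -
  let ?W = "window g \<alpha> r0 r e"
  let ?pair = "\<lambda>h (v :: real ^ 'a). \<Sum>a\<in>UNIV. h a * v $ a"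
  define K where "K = {v :: real ^ 'a. (\<forall>a. 0 \<le> v $ a) \<and> (\<Sum>a\<in>UNIV. v $ a) = 1 \<and>
    (\<forall>j\<in>{1..r0}. \<bar>?pair (g j) v - \<alpha> j\<bar> \<le> e) \<and> (\<forall>j\<in>{r0<..r}. ?pair (g j) v \<ge> \<alpha> j - e)}"
  define \<Phi> where "\<Phi> v = (\<Sum>a\<in>UNIV. v $ a * ln (v $ a / pmf P a))" for v :: "real ^ 'a"
  have K_vec: "(\<chi> a. pmf q a) \<in> K \<longleftrightarrow> q \<in> ?W" for q
    by (simp add: K_def window_def pairing_def sum_pmf_UNIV)
  have \<Phi>_vec: "\<Phi> (\<chi> a. pmf q a) = rel_entropy q P" for q
    by (simp add: \<Phi>_def rel_entropy_def)
  have "K = (\<Inter>a. {v. 0 \<le> v $ a}) \<inter> {v. (\<Sum>a\<in>UNIV. v $ a) = 1} \<inter>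
      (\<Inter>j\<in>{1..r0}. {v. \<bar>?pair (g j) v - \<alpha> j\<bar> \<le> e}) \<inter> (\<Inter>j\<in>{r0<..r}. {v. \<alpha> j - e \<le> ?pair (g j) v})"
    unfolding K_def by blast
  also have "closed \<dots>"
    by (intro closed_Int closed_INT ballI closed_Collect_le closed_Collect_eq continuous_intros)
  finally have "closed K" .
  moreover have "bounded K"
  proof (rule bounded_subset)
    show "K \<subseteq> cball 0 1"
    proof
      fix v assume v: "v \<in> K"
      have "norm v \<le> (\<Sum>a\<in>UNIV. \<bar>v $ a\<bar>)" by (rule norm_le_l1_cart)
      also have "\<dots> = (\<Sum>a\<in>UNIV. v $ a)" using v by (simp add: K_def)
      also have "\<dots> = 1" using v by (simp add: K_def)
      finally show "v \<in> cball 0 1" by simp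
    qed
  qed simp
  ultimately have "compact K" by (simp add: compact_eq_bounded_closed)
  moreover have "K \<noteq> {}" using ne K_vec by blast
  moreover have "continuous_on K \<Phi>"
    unfolding \<Phi>_def
    by (intro continuous_on_sum continuous_on_compose2[OF continuous_on_mult_ln[OF P]] continuous_intros)
       (auto simp: K_def)
  ultimately have "\<exists>v\<in>K. \<forall>u\<in>K. \<Phi> v \<le> \<Phi> u" by (rule continuous_attains_inf)
  then obtain v where v: "v \<in> K" "\<And>u. u \<in> K \<Longrightarrow> \<Phi> v \<le> \<Phi> u" by blast
  have "\<And>a. 0 \<le> v $ a" "(\<Sum>a\<in>UNIV. v $ a) = 1" using v(1) by (auto simp: K_def)
  then obtain q where "\<And>a. pmf q a = v $ a"
    using exists_pmf_with_masses[of "\<lambda>a. v $ a"] by blast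
  then have q: "(\<chi> a. pmf q a) = v" by (simp add: vec_eq_iff)
  have "is_arg_min (\<lambda>Q. rel_entropy Q P) (\<lambda>Q. Q \<in> ?W) q"
    unfolding is_arg_min_linorder
  proof (intro conjI allI impI)
    show "q \<in> ?W" using v(1) K_vec[of q] by (simp only: q)
    fix R assume "R \<in> ?W"
    then have "\<Phi> v \<le> \<Phi> (\<chi> a. pmf R a)" by (intro v(2) K_vec[THEN iffD2])
    then show "rel_entropy q P \<le> rel_entropy R P" unfolding q[symmetric] \<Phi>_vec .
  qed
  then have "is_arg_min (\<lambda>Q. rel_entropy Q P) (\<lambda>Q. Q \<in> ?W) (I_proj P ?W)"
    unfolding I_proj_def arg_min_on_def arg_min_def by (rule someI)
  then show "I_proj P ?W \<in> ?W" "Q \<in> ?W \<Longrightarrow> rel_entropy (I_proj P ?W) P \<le> rel_entropy Q P"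
    unfolding is_arg_min_linorder by auto
qed

subsection \<open>The conditional limit theorem\<close>

lemma prob_cond_pmf:
  assumes "set_pmf p \<inter> s \<noteq> {}"
  shows "measure_pmf.prob (cond_pmf p s) A = measure_pmf.prob p (s \<inter> A) / measure_pmf.prob p s"
  unfolding cond_pmf.rep_eq[OF assms]
  by (subst measure_uniform_measure) (use assms in \<open>auto simp: emeasure_measure_pmf_not_zero Int_commute\<close>)

text \<open>A single type in \<open>S\<close> suffices; \<open>L\<close> bounds the excess of its
  exponent over \<open>N * d\<close>.\<close>

lemma sanov_lower_bound:
  fixes P :: "'a::finite pmf"
  assumes "N > 0" and P: "\<And>a. pmf P a > 0" and R: "R \<in> S" "R \<in> types N"
    and d: "real N * rel_entropy R P \<le> real N * d + L"
  shows "exp (- real N * d - L) / (real N + 1) ^ CARD('a)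
    \<le> measure_pmf.prob (iid_law {1..N} P) (cond_event N S)"
proof -
  have "exp (- real N * d - L) / (real N + 1) ^ CARD('a)
      \<le> exp (- real N * rel_entropy R P) / (real N + 1) ^ CARD('a)"
    using d by (intro divide_right_mono) auto
  also have "\<dots> \<le> measure_pmf.prob (iid_law {1..N} P) {x. empirical N x = R}"
    using assms by (intro prob_empirical_eq_ge)
  also have "\<dots> \<le> measure_pmf.prob (iid_law {1..N} P) (cond_event N S)"
    using R by (intro measure_pmf.finite_measure_mono) (auto simp: cond_event_def)
  finally show ?thesis .
qed

text \<open>The optimal exponents of numerator and denominator cancel, leaving the gap
  \<open>2 * \<delta>\<^sup>2\<close> and the loss \<open>exp L\<close>. One factor
  \<open>(N + 1) ^ CARD('a)\<close> counts the bad types, the other comes from the lower bound for a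
  single type.\<close>

lemma bad_prob_le:
  fixes P :: "'a::finite pmf" and S :: "'a pmf set"
  defines "p \<equiv> I_proj P S"
  assumes "N > 0" and P: "\<And>a. pmf P a > 0" and p: "\<And>a. pmf p a > 0"
    and pyth: "\<And>Q. Q \<in> S \<Longrightarrow> rel_entropy Q p + rel_entropy p P \<le> rel_entropy Q P"
    and R: "R \<in> S" "R \<in> types N"
    and L: "real N * rel_entropy R P \<le> real N * rel_entropy p P + L" and "\<delta> > 0"
  shows "bad_prob N P S \<delta> \<le> exp L * (real N + 1) ^ (2 * CARD('a)) * exp (- 2 * real N * \<delta>\<^sup>2)"
proof -
  let ?p = "measure_pmf.prob (iid_law {1..N} P)"
  let ?k = "(real N + 1) ^ CARD('a)"
  let ?D = "rel_entropy p P"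
  have k: "?k > 0" by simp
  have low: "exp (- real N * ?D - L) / ?k \<le> ?p (cond_event N S)"
    using sanov_lower_bound[OF \<open>N > 0\<close> P R L] .
  moreover have "0 < exp (- real N * ?D - L) / ?k" using k by simp
  ultimately have pos: "?p (cond_event N S) > 0" by linarith
  then have "set_pmf (iid_law {1..N} P) \<inter> cond_event N S \<noteq> {}"
    by (metis measure_Int_set_pmf inf_commute measure_empty less_irrefl)
  then have "bad_prob N P S \<delta>
      = ?p (cond_event N S \<inter> {x. empirical N x \<in> bad_types N P S \<delta>}) / ?p (cond_event N S)"
    unfolding bad_prob_def by (rule prob_cond_pmf)
  also have "\<dots> \<le> ?p {x. empirical N x \<in> bad_types N P S \<delta>} / ?p (cond_event N S)"
    by (intro divide_right_mono measure_pmf.finite_measure_mono) auto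
  also have "\<dots> \<le> (?k * exp (- real N * (?D + 2 * \<delta>\<^sup>2))) / ?p (cond_event N S)"
  proof (intro divide_right_mono prob_empirical_in_le)
    fix Q assume "Q \<in> bad_types N P S \<delta>"
    then have Q: "Q \<in> S" "tv_dist Q p > \<delta>" by (auto simp: bad_types_def p_def)
    have "\<delta>\<^sup>2 \<le> (tv_dist Q p)\<^sup>2" using Q \<open>\<delta> > 0\<close> by (intro power_mono) auto
    then show "?D + 2 * \<delta>\<^sup>2 \<le> rel_entropy Q P"
      using pyth[OF Q(1)] pinsker[OF p, of Q] by simp
  qed (use assms in auto)
  also have "\<dots> \<le> (?k * exp (- real N * (?D + 2 * \<delta>\<^sup>2))) / (exp (- real N * ?D - L) / ?k)"
    using low k pos by (intro divide_left_mono) auto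
  also have "\<dots> = exp L * ?k\<^sup>2 * exp (- 2 * real N * \<delta>\<^sup>2)"
    by (simp add: exp_diff exp_minus exp_add distrib_left field_simps power2_eq_square)
  also have "?k\<^sup>2 = (real N + 1) ^ (2 * CARD('a))" by (simp add: power_even_eq)
  finally show ?thesis .
qed

text \<open>The type in the window is a rounding of the projection onto the slightly smaller window of
  width \<open>e - c_rnd g r / N\<close>; assumption (A5) keeps it within \<open>O(1/N)\<close> of the projection onto the
  full window, so that its relative entropy is optimal up to \<open>O(1/N)\<close>.\<close>

lemma exists_near_optimal_type:
  fixes P :: "'a::finite pmf" and g :: "nat \<Rightarrow> 'a \<Rightarrow> real" and \<alpha> :: "nat \<Rightarrow> real" and r0 r :: nat
  defines "pr \<equiv> \<lambda>e. I_proj P (window g \<alpha> r0 r e)"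
  assumes "r \<ge> 1" "r0 \<le> r" and P: "\<And>a. \<kappa> \<le> pmf P a" and "\<kappa> > 0"
    and ne: "window g \<alpha> r0 r 0 \<noteq> {}"
    and lip: "\<And>e e'. e \<in> {0..\<eta>} \<Longrightarrow> e' \<in> {0..\<eta>} \<Longrightarrow> tv_dist (pr e) (pr e') \<le> C0 * \<bar>e - e'\<bar>"
    and N: "N > 0" "real N * e > c_rnd g r" and e: "e \<le> \<eta>" and p: "\<And>a. \<kappa> \<le> pmf (pr e) a"
  shows "\<exists>R. R \<in> window g \<alpha> r0 r e \<and> R \<in> types N \<and>
    real N * rel_entropy R P \<le> real N * rel_entropy (pr e) P +
      real CARD('a) * ((1 + C0 * c_rnd g r) * (- ln \<kappa>) + (1 + C0 * c_rnd g r)\<^sup>2 / \<kappa>)"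
proof -
  \<comment> \<open>In units of 1/N, the 1 is the rounding error and the other summand the movement
    of the projection between the widths \<open>e'\<close> and \<open>e\<close>.\<close>
  define c where "c = 1 + C0 * c_rnd g r"
  \<comment> \<open>Rounding may shift each constraint by \<open>c_rnd g r / N\<close>; the lower
    bound on \<open>N * e\<close> leaves this much room, so \<open>e'\<close> is still
    positive.\<close>
  define e' where "e' = e - c_rnd g r / real N"
  have "e > c_rnd g r / real N" using N by (simp add: field_simps)
  moreover have "c_rnd g r / real N \<ge> 0" using c_rnd_nonneg[OF \<open>r \<ge> 1\<close>, of g] by simp
  ultimately have e': "e \<in> {0..\<eta>}" "e' \<in> {0..\<eta>}" "\<bar>e - e'\<bar> = c_rnd g r / real N"
    using e by (auto simp: e'_def simp del: abs_divide)
  have P0: "pmf P a > 0" and p0: "pmf (pr e) a > 0" for a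
    using P[of a] p[of a] \<open>\<kappa> > 0\<close> by linarith+
  have "window g \<alpha> r0 r e' \<noteq> {}" using ne window_mono[of 0 e' g \<alpha> r0 r] e'(2) by auto
  then have pr': "pr e' \<in> window g \<alpha> r0 r e'"
    unfolding pr_def using P0 by (intro I_proj_window)
  obtain R where R: "R \<in> types N" "\<And>a. \<bar>pmf R a - pmf (pr e') a\<bar> \<le> 1 / real N"
    using exists_type_near[OF N(1), of "pr e'"] by auto
  have "R \<in> window g \<alpha> r0 r (e' + c_rnd g r * (1 / real N))"
    using window_enlarge[OF \<open>r0 \<le> r\<close> pr' R(2)] .
  then have RW: "R \<in> window g \<alpha> r0 r e" by (simp add: e'_def)
  have near: "\<bar>pmf R a - pmf (pr e) a\<bar> \<le> c / real N" for a
  proof -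
    have "\<bar>pmf (pr e) a - pmf (pr e') a\<bar> \<le> C0 * (c_rnd g r / real N)"
      using abs_pmf_diff_le_tv_dist[of "pr e" a "pr e'"] lip[OF e'(1,2)] e'(3) by simp
    then have "\<bar>pmf R a - pmf (pr e) a\<bar> \<le> 1 / real N + C0 * (c_rnd g r / real N)"
      using R(2)[of a] by linarith
    then show ?thesis by (simp add: c_def add_divide_distrib)
  qed
  have c: "c \<ge> 0"
  proof -
    have "0 \<le> c / real N" using near[of undefined] by (rule order_trans[OF abs_ge_zero])
    then show ?thesis using N(1) by (simp add: zero_le_divide_iff)
  qed
  \<comment> \<open>Both masses lie between \<kappa> and 1, so both logarithms lie between
    \<open>ln \<kappa>\<close> and 0.\<close>
  have ln_ratio: "\<bar>ln (pmf (pr e) a / pmf P a)\<bar> \<le> - ln \<kappa>" for a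
  proof -
    have "ln \<kappa> \<le> ln (pmf (pr e) a)" "ln \<kappa> \<le> ln (pmf P a)"
      using p[of a] P[of a] \<open>\<kappa> > 0\<close> by (auto intro!: ln_mono)
    moreover have "ln (pmf (pr e) a) \<le> 0" "ln (pmf P a) \<le> 0"
      using p0[of a] P0[of a] by (auto simp: pmf_le_1)
    moreover have "ln (pmf (pr e) a / pmf P a) = ln (pmf (pr e) a) - ln (pmf P a)"
      using p0[of a] P0[of a] by (simp add: ln_div)
    ultimately show ?thesis by linarith
  qed
  have lin: "(pmf R a - pmf (pr e) a) * ln (pmf (pr e) a / pmf P a) \<le> c / real N * (- ln \<kappa>)" for a
  proof (rule order_trans[OF abs_ge_self])
    show "\<bar>(pmf R a - pmf (pr e) a) * ln (pmf (pr e) a / pmf P a)\<bar> \<le> c / real N * (- ln \<kappa>)"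
      unfolding abs_mult using near[of a] c by (intro mult_mono ln_ratio) auto
  qed
  have quad: "(pmf R a - pmf (pr e) a)\<^sup>2 / pmf (pr e) a \<le> (c / real N)\<^sup>2 / \<kappa>" for a
    using near[of a] p[of a] \<open>\<kappa> > 0\<close> power_mono[OF near[of a], of 2]
    by (intro frac_le) auto
  have "rel_entropy R P \<le> rel_entropy (pr e) P
      + (\<Sum>a\<in>(UNIV :: 'a set). c / real N * (- ln \<kappa>)) + (\<Sum>a\<in>(UNIV :: 'a set). (c / real N)\<^sup>2 / \<kappa>)"
    by (rule order_trans[OF rel_entropy_expansion_le[OF p0 P0]]) (intro add_mono sum_mono order_refl lin quad)
  also have "\<dots> = rel_entropy (pr e) P + real CARD('a) * (c / real N * (- ln \<kappa>) + (c / real N)\<^sup>2 / \<kappa>)"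
    by (simp add: algebra_simps)
  finally have "real N * rel_entropy R P \<le> real N * (rel_entropy (pr e) P
      + real CARD('a) * (c / real N * (- ln \<kappa>) + (c / real N)\<^sup>2 / \<kappa>))"
    by (intro mult_left_mono) auto
  \<comment> \<open>Multiplication by \<open>N\<close> leaves the linear term bounded and the
    quadratic term of order 1/N, so the excess stays bounded in \<open>N\<close>.\<close>
  also have "\<dots> = real N * rel_entropy (pr e) P + real CARD('a) * (c * (- ln \<kappa>) + c\<^sup>2 / \<kappa> / real N)"
    using N(1) by (simp add: field_simps power2_eq_square)
  also have "\<dots> \<le> real N * rel_entropy (pr e) P + real CARD('a) * (c * (- ln \<kappa>) + c\<^sup>2 / \<kappa>)"
  proof -
    have "c\<^sup>2 / \<kappa> / real N \<le> c\<^sup>2 / \<kappa> / 1"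
      using N(1) \<open>\<kappa> > 0\<close> by (intro divide_left_mono) auto
    then show ?thesis by (intro add_left_mono mult_left_mono) auto
  qed
  finally have "real N * rel_entropy R P
      \<le> real N * rel_entropy (pr e) P + real CARD('a) * (c * (- ln \<kappa>) + c\<^sup>2 / \<kappa>)" .
  then show ?thesis using RW R(1) unfolding c_def by blast
qed

text \<open>The constant is chosen before the sequence \<epsilon>, hence depends only on
  \<open>P\<close> and the constraint data. The positivity clause ensures that
  \<open>cond_pmf\<close> is a genuine conditional law.\<close>

theorem proposition1:
  fixes P :: "'a::finite pmf"
    and g :: "nat \<Rightarrow> 'a \<Rightarrow> real" and \<alpha> :: "nat \<Rightarrow> real" and r0 r :: nat
  assumes "r \<ge> 1" and "r0 \<le> r"
    and A2: "\<And>x. pmf P x > 0"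
    and A3: "constraint_set g \<alpha> r0 r \<noteq> {}"
    and A4: "\<And>x. pmf (I_proj P (constraint_set g \<alpha> r0 r)) x > 0"
    and A5: "\<exists>C0 \<eta>. \<eta> > 0 \<and> (\<forall>\<epsilon>\<in>{0..\<eta>}. \<forall>\<epsilon>'\<in>{0..\<eta>}.
               tv_dist (I_proj P (window g \<alpha> r0 r \<epsilon>)) (I_proj P (window g \<alpha> r0 r \<epsilon>'))
                 \<le> C0 * \<bar>\<epsilon> - \<epsilon>'\<bar>)"
  shows "\<exists>C::real. \<forall>\<epsilon> :: nat \<Rightarrow> real.
           decseq \<epsilon> \<longrightarrow> \<epsilon> \<longlonglongrightarrow> 0 \<longrightarrow>
           (\<forall>\<^sub>F N in sequentially. real N * \<epsilon> N > c_rnd g r) \<longrightarrow>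
           (\<forall>\<^sub>F N in sequentially.
              measure_pmf.prob (iid_law {1..N} P) (cond_event N (window g \<alpha> r0 r (\<epsilon> N))) > 0 \<and>
              (\<forall>\<delta>>0. \<forall>m I. I \<subseteq> {1..N} \<and> card I = m \<longrightarrow>
                 tv_dist (cond_law N I P (window g \<alpha> r0 r (\<epsilon> N)))
                         (iid_law I (I_proj P (window g \<alpha> r0 r (\<epsilon> N))))
                   \<le> real m * \<delta> + real m * (real m - 1) / (2 * real N)
                     + bad_prob N P (window g \<alpha> r0 r (\<epsilon> N)) \<delta>
                 \<and> bad_prob N P (window g \<alpha> r0 r (\<epsilon> N)) \<delta>
                   \<le> C * (real N + 1) ^ (2 * CARD('a)) * exp (- 2 * real N * \<delta>\<^sup>2)))"
proof -
  define W where "W e = window g \<alpha> r0 r e" for e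
  define pr where "pr e = I_proj P (W e)" for e
  obtain C0 \<eta> where \<eta>: "\<eta> > 0"
    and lip: "\<And>e e'. e \<in> {0..\<eta>} \<Longrightarrow> e' \<in> {0..\<eta>} \<Longrightarrow> tv_dist (pr e) (pr e') \<le> C0 * \<bar>e - e'\<bar>"
    using A5 unfolding pr_def W_def by blast
  have W0: "W 0 = constraint_set g \<alpha> r0 r" unfolding W_def by (rule window_zero)
  define \<kappa>0 where "\<kappa>0 = (MIN a. pmf (pr 0) a)"
  \<comment> \<open>Half of the least mass of the projection onto \<open>W 0\<close> is given up, so
    that by (A5) \<kappa> still bounds the masses of the projections for small widths. Including
    \<open>P\<close> lets one \<kappa> control all log-ratios.\<close>
  define \<kappa> where "\<kappa> = min (\<kappa>0 / 2) (MIN a. pmf P a)"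
  have \<kappa>0: "\<kappa>0 > 0" "\<And>a. \<kappa>0 \<le> pmf (pr 0) a"
    using A4 unfolding \<kappa>0_def pr_def W0 by (auto intro!: Min_le)
  have \<kappa>: "\<kappa> > 0" using \<kappa>0 A2 unfolding \<kappa>_def by simp
  have \<kappa>_P: "\<kappa> \<le> pmf P a" for a
    unfolding \<kappa>_def by (rule min.coboundedI2) (auto intro!: Min_le)
  have C0: "C0 \<ge> 0"
    using order_trans[OF tv_dist_nonneg lip[of 0 \<eta>]] \<eta> by (simp add: zero_le_mult_iff)
  define L where "L = real CARD('a) * ((1 + C0 * c_rnd g r) * (- ln \<kappa>) + (1 + C0 * c_rnd g r)\<^sup>2 / \<kappa>)"
  \<comment> \<open>The estimate for fixed \<open>N\<close> and \<open>e\<close>. Of the two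
    smallness conditions on \<open>e\<close>, one gives access to (A5) and the other keeps the
    projection away from the boundary of the simplex.\<close>
  have main: "measure_pmf.prob (iid_law {1..N} P) (cond_event N (W e)) > 0 \<and>
      (\<forall>\<delta>>0. \<forall>m I. I \<subseteq> {1..N} \<and> card I = m \<longrightarrow>
         tv_dist (cond_law N I P (W e)) (iid_law I (pr e))
           \<le> real m * \<delta> + real m * (real m - 1) / (2 * real N) + bad_prob N P (W e) \<delta>
         \<and> bad_prob N P (W e) \<delta> \<le> exp L * (real N + 1) ^ (2 * CARD('a)) * exp (- 2 * real N * \<delta>\<^sup>2))"
    if N: "N > 0" "real N * e > c_rnd g r" and e: "e \<le> \<eta>" "C0 * e \<le> \<kappa>0 / 2" for N e
  proof -
    have "real N * e > 0" using N(2) c_rnd_nonneg[OF \<open>r \<ge> 1\<close>, of g] by linarith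
    then have e0: "e > 0" using N(1) by (simp add: zero_less_mult_iff)
    have p: "\<kappa> \<le> pmf (pr e) a" for a
    proof -
      have "\<bar>pmf (pr 0) a - pmf (pr e) a\<bar> \<le> C0 * e"
        using order_trans[OF abs_pmf_diff_le_tv_dist lip[of 0 e]] e e0 by simp
      then have "\<kappa>0 / 2 \<le> pmf (pr e) a" using \<kappa>0(2)[of a] e(2) by linarith
      then show ?thesis unfolding \<kappa>_def by linarith
    qed
    then have p0: "pmf (pr e) a > 0" for a using \<kappa> less_le_trans by blast
    have ne0: "W 0 \<noteq> {}" using A3 W0 by simp
    then have ne: "W e \<noteq> {}" using window_mono[of 0 e g \<alpha> r0 r] e0 unfolding W_def by auto
    have prW: "pr e \<in> W e" and pr_min: "\<And>Q. Q \<in> W e \<Longrightarrow> rel_entropy (pr e) P \<le> rel_entropy Q P"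
      using I_proj_window[OF A2 ne[unfolded W_def]] unfolding pr_def W_def by auto
    have pyth: "rel_entropy Q (pr e) + rel_entropy (pr e) P \<le> rel_entropy Q P" if Q: "Q \<in> W e" for Q
    proof (rule rel_entropy_pythagoras[OF p0 A2])
      fix t R assume t: "0 < t" "t \<le> 1" and R: "\<And>a. pmf R a = pmf (pr e) a + t * (pmf Q a - pmf (pr e) a)"
      have "R \<in> W e"
        unfolding W_def
        by (rule window_convex[OF prW[unfolded W_def] Q[unfolded W_def] less_imp_le[OF t(1)] t(2) R])
      then show "rel_entropy (pr e) P \<le> rel_entropy R P" by (rule pr_min)
    qed
    obtain R where R: "R \<in> W e" "R \<in> types N"
      "real N * rel_entropy R P \<le> real N * rel_entropy (pr e) P + L"
      using exists_near_optimal_type[OF assms(1,2) \<kappa>_P \<kappa> ne0[unfolded W_def]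
          lip[unfolded pr_def W_def] N e(1) p[unfolded pr_def W_def]]
      unfolding pr_def W_def L_def by blast
    have "exp (- real N * rel_entropy (pr e) P - L) / (real N + 1) ^ CARD('a)
        \<le> measure_pmf.prob (iid_law {1..N} P) (cond_event N (W e))"
      using sanov_lower_bound[OF N(1) A2 R] .
    moreover have "0 < exp (- real N * rel_entropy (pr e) P - L) / (real N + 1) ^ CARD('a)" by simp
    ultimately have pos: "measure_pmf.prob (iid_law {1..N} P) (cond_event N (W e)) > 0" by linarith
    then have "set_pmf (iid_law {1..N} P) \<inter> cond_event N (W e) \<noteq> {}"
      by (metis measure_Int_set_pmf inf_commute measure_empty less_irrefl)
    \<comment> \<open>An empirical measure in the window is a type, so if it is not bad it lies
      within \<delta> of the projection; the exceptional set is the event of a bad type.\<close>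
    then have "tv_dist (cond_law N I P (W e)) (iid_law I (pr e))
           \<le> real (card I) * \<delta> + real (card I) * (real (card I) - 1) / (2 * real N) + bad_prob N P (W e) \<delta>"
      if "\<delta> > 0" "I \<subseteq> {1..N}" for \<delta> I
      unfolding bad_prob_def
      using that empirical_in_types[OF N(1)] unfolding pr_def
      by (intro tv_dist_cond_law[OF N(1)]) (auto simp: bad_types_def not_less)
    moreover have "bad_prob N P (W e) \<delta> \<le> exp L * (real N + 1) ^ (2 * CARD('a)) * exp (- 2 * real N * \<delta>\<^sup>2)"
      if "\<delta> > 0" for \<delta>
      using bad_prob_le[OF N(1) A2 p0[unfolded pr_def] pyth[unfolded pr_def] R[unfolded pr_def] that] by simp
    ultimately show ?thesis using pos by blast
  qed
  show ?thesis
  proof (rule exI[of _ "exp L"], intro allI impI)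
    fix \<epsilon> :: "nat \<Rightarrow> real"
    assume lim: "\<epsilon> \<longlonglongrightarrow> 0" and big: "\<forall>\<^sub>F N in sequentially. real N * \<epsilon> N > c_rnd g r"
    have "(\<lambda>N. C0 * \<epsilon> N) \<longlonglongrightarrow> C0 * 0" by (intro tendsto_intros lim)
    then have "\<forall>\<^sub>F N in sequentially. C0 * \<epsilon> N < \<kappa>0 / 2"
      using \<kappa>0(1) by (intro order_tendstoD(2)) auto
    moreover have "\<forall>\<^sub>F N in sequentially. \<epsilon> N < \<eta>" using order_tendstoD(2)[OF lim \<eta>] .
    ultimately show "\<forall>\<^sub>F N in sequentially.
              measure_pmf.prob (iid_law {1..N} P) (cond_event N (window g \<alpha> r0 r (\<epsilon> N))) > 0 \<and>
              (\<forall>\<delta>>0. \<forall>m I. I \<subseteq> {1..N} \<and> card I = m \<longrightarrow>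
                 tv_dist (cond_law N I P (window g \<alpha> r0 r (\<epsilon> N)))
                         (iid_law I (I_proj P (window g \<alpha> r0 r (\<epsilon> N))))
                   \<le> real m * \<delta> + real m * (real m - 1) / (2 * real N)
                     + bad_prob N P (window g \<alpha> r0 r (\<epsilon> N)) \<delta>
                 \<and> bad_prob N P (window g \<alpha> r0 r (\<epsilon> N)) \<delta>
                   \<le> exp L * (real N + 1) ^ (2 * CARD('a)) * exp (- 2 * real N * \<delta>\<^sup>2))"
      using big eventually_gt_at_top[of 0]
    proof eventually_elim
      case (elim N)
      then show ?case using main[of N "\<epsilon> N"] unfolding pr_def W_def by simp
    qed
  qed
qed

end
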